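(* Let $(W,S)$ be a generalized Coxeter datum with $S=\{s_1,\dots,s_n\}$, $|S|=n$, set of reflections $T$ and $c=s_1\cdots s_n$, such that $\ell_T(c)=n$. Suppose there exist a Coxeter system $(\overline W,\overline S)$ with $\overline S=\{\bar s_1,\dots,\bar s_{n-1}\}$ and set of reflections $\overline T$, and a group epimorphism $p\colon W\to\overline W$ such that: (T1) $p(s_i)=\bar s_i$ for $1\le i\le n-1$, and $p(s_n)=\bar s_{n-1}$. (T2) Every $\bar t\in\overline T$ for which there exists $(t_1,\dots,t_n)\in\mathrm{Red}_T(c)$ with $(p(t_1),\dots,p(t_n))=(\bar s_1,\dots,\bar s_{n-2},\bar t,\bar t)$ is conjugate to $\bar s_{n-1}$ under the subgroup of $\overline W$ generated by $\bar s_1,\dots,\bar s_{n-2}$. (T3) For every $(t_1,\dots,t_n)\in\mathrm{Red}_T(c)$ with $(p(t_1),\dots,p(t_n))=(\bar s_1,\dots,\bar s_{n-2},\bar s_{n-1},\bar s_{n-1})$, the tuples $(t_1,\dots,t_n)$ and $(s_1,\dots,s_n)$ lie in the same orbit under the Hurwitz action of the subgroup $\langle\sigma_{n-1}\rangle$ of the braid group $B_n$. Then the Hurwitz action of $B_n$ on $\mathrm{Red}_T(c)$ is transitive.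
   Context: Generalized Coxeter datum: let $V$ be a finite-dimensional real vector space with a symmetric bilinear form $B=(-,-)$ (of any signature) and let $\alpha_1,\dots,\alpha_n\in V$ be non-isotropic vectors, i.e. $(\alpha_i,\alpha_i)\ne0$. Let $s_i=s_{\alpha_i}$ be the reflection $x\mapsto x-2\frac{(x,\alpha_i)}{(\alpha_i,\alpha_i)}\alpha_i$, $S=\{s_1,\dots,s_n\}$, $W$ the group generated by $S$, and $T=\{wsw^{-1}\mid w\in W,s\in S\}$ the set of reflections. (This includes the case where $V=\mathbb{R}\otimes_{\mathbb Z}\Gamma$, $(\Gamma,K)$ is a lattice with a non-degenerate bilinear form, $B$ is the symmetrization of $K$, and the $\alpha_i$ form a complete exceptional sequence of $(\Gamma,K)$.) For $w\in W$, $\ell_T(w)$ is the minimal $r$ such that $w$ is a product of $r$ elements of $T$. $\mathrm{Red}_T(c)=\{(t_1,\dots,t_n)\in T^n\mid t_1\cdots t_n=c\}$ where $n=\ell_T(c)$. For a Coxeter system $(\overline W,\overline S)$, $\overline T$ is the set of conjugates of elements of $\overline S$. The braid group $B_n$ with standard generators $\sigma_1,\dots,\sigma_{n-1}$ acts on $T^n$ by the Hurwitz action $\sigma_i(t_1,\dots,t_n)=(t_1,\dots,t_{i-1},t_{i+1},t_{i+1}^{-1}t_it_{i+1},t_{i+2},\dots,t_n)$, which preserves $\mathrm{Red}_T(c)$. *)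

theory Defs
  imports
    "HOL-Analysis.Linear_Algebra"
    "HOL-Library.Extended_Nat"
    "HOL-Algebra.Generated_Groups"
    "HOL-Algebra.Group_Action"
begin

section \<open>Groups given by generators and relations\<close>

text \<open>A word over \<open>S\<close> is a list of letters \<open>(s, e)\<close> with \<open>s \<in> S\<close>; the letter \<open>(s, True)\<close> stands
  for \<open>s\<close> and \<open>(s, False)\<close> for the formal inverse of \<open>s\<close>. Relations are pairs of words \<open>(l, r)\<close>,
  read as \<open>l = r\<close>.\<close>

type_synonym 's word = "('s \<times> bool) list"

definition words :: "'s set \<Rightarrow> 's word set" where
  "words S = lists (S \<times> UNIV)"

inductive_set pres_cong :: "'s set \<Rightarrow> ('s word \<times> 's word) set \<Rightarrow> ('s word \<times> 's word) set"
  for S R where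
  refl: "u \<in> words S \<Longrightarrow> (u, u) \<in> pres_cong S R"
| sym: "(u, v) \<in> pres_cong S R \<Longrightarrow> (v, u) \<in> pres_cong S R"
| trans: "(u, v) \<in> pres_cong S R \<Longrightarrow> (v, w) \<in> pres_cong S R \<Longrightarrow> (u, w) \<in> pres_cong S R"
| cancel: "x \<in> words S \<Longrightarrow> y \<in> words S \<Longrightarrow> s \<in> S \<Longrightarrow>
    (x @ [(s, e), (s, \<not> e)] @ y, x @ y) \<in> pres_cong S R"
| relation: "x \<in> words S \<Longrightarrow> y \<in> words S \<Longrightarrow> l \<in> words S \<Longrightarrow> r \<in> words S \<Longrightarrow> (l, r) \<in> R \<Longrightarrow>
    (x @ l @ y, x @ r @ y) \<in> pres_cong S R"

definition presented_group ::
    "'s set \<Rightarrow> ('s word \<times> 's word) set \<Rightarrow> 's word set monoid" where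
  "presented_group S R =
    \<lparr>carrier = words S // pres_cong S R,
     mult = (\<lambda>A B. \<Union>u\<in>A. \<Union>v\<in>B. pres_cong S R `` {u @ v}),
     one = pres_cong S R `` {[]}\<rparr>"

definition pres_gen :: "'s set \<Rightarrow> ('s word \<times> 's word) set \<Rightarrow> 's \<Rightarrow> 's word set" where
  "pres_gen S R s = pres_cong S R `` {[(s, True)]}"

lemma words_simps [simp]:
  "[] \<in> words S" "(a # u) \<in> words S \<longleftrightarrow> fst a \<in> S \<and> u \<in> words S"
  "u @ v \<in> words S \<longleftrightarrow> u \<in> words S \<and> v \<in> words S"
  by (auto simp: words_def mem_Times_iff)

lemma pres_cong_words: "(u, v) \<in> pres_cong S R \<Longrightarrow> u \<in> words S \<and> v \<in> words S"
  by (induction rule: pres_cong.induct) auto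

lemma equiv_pres_cong: "equiv (words S) (pres_cong S R)"
  by (intro equivI refl_onI symI transI)
    (auto intro: pres_cong.intros dest: pres_cong_words)

lemma pres_cong_context:
  assumes "(u, v) \<in> pres_cong S R" "x \<in> words S" "y \<in> words S"
  shows "(x @ u @ y, x @ v @ y) \<in> pres_cong S R"
  using assms
proof (induction rule: pres_cong.induct)
  case (refl u) then show ?case by (auto intro: pres_cong.refl)
next
  case (sym u v) then show ?case by (auto intro: pres_cong.sym)
next
  case (trans u v w) then show ?case by (blast intro: pres_cong.trans)
next
  case (cancel x' y' s e)
  then show ?case using pres_cong.cancel[of "x @ x'" S "y' @ y" s e R] by simp
next
  case (relation x' y' l r)
  then show ?case using pres_cong.relation[of "x @ x'" S "y' @ y" l r R] by simp
qed

lemma pres_cong_append: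
  assumes "(u, u') \<in> pres_cong S R" "(v, v') \<in> pres_cong S R"
  shows "(u @ v, u' @ v') \<in> pres_cong S R"
  using pres_cong_context[OF assms(1), of "[]" v] pres_cong_context[OF assms(2), of u' "[]"]
    pres_cong_words[OF assms(1)] pres_cong_words[OF assms(2)]
  by (auto intro: pres_cong.trans)

lemma pres_mult:
  assumes "u \<in> words S" "v \<in> words S"
  shows "pres_cong S R `` {u} \<otimes>\<^bsub>presented_group S R\<^esub> pres_cong S R `` {v} =
    pres_cong S R `` {u @ v}"
proof -
  have "(\<lambda>u v. pres_cong S R `` {u @ v}) respects2 pres_cong S R"
    by (intro congruent2I' equiv_class_eq[OF equiv_pres_cong] pres_cong_append)
  then show ?thesis
    using UN_equiv_class2[OF equiv_pres_cong equiv_pres_cong _ assms] by (simp add: presented_group_def)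
qed

lemma pres_inverse:
  assumes "u \<in> words S"
  shows "(rev (map (\<lambda>(s, e). (s, \<not> e)) u) @ u, []) \<in> pres_cong S R"
  using assms
proof (induction u)
  case Nil show ?case by (simp add: pres_cong.refl)
next
  case (Cons a u)
  obtain s e where a: "a = (s, e)" by (cases a)
  have "(\<lambda>(s, e). (s, \<not> e)) ` set u \<subseteq> S \<times> UNIV" using Cons.prems by (auto simp: words_def)
  then have "rev (map (\<lambda>(s, e). (s, \<not> e)) u) \<in> words S"
    by (simp add: words_def in_lists_conv_set image_subset_iff)
  then have "(rev (map (\<lambda>(s, e). (s, \<not> e)) u) @ [(s, \<not> e), (s, \<not> \<not> e)] @ u,
      rev (map (\<lambda>(s, e). (s, \<not> e)) u) @ u) \<in> pres_cong S R"
    using Cons.prems a by (intro pres_cong.cancel) auto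
  with Cons show ?case by (auto simp: a intro: pres_cong.trans)
qed

lemma group_presented_group: "group (presented_group S R)"
proof -
  let ?P = "presented_group S R" and ?c = "\<lambda>u. pres_cong S R `` {u}"
  have in_carr: "x \<in> carrier ?P \<longleftrightarrow> (\<exists>u\<in>words S. x = ?c u)" for x
    by (auto simp: presented_group_def quotient_def)
  have one: "\<one>\<^bsub>?P\<^esub> = ?c []" by (simp add: presented_group_def)
  show ?thesis
  proof (rule groupI)
    fix x assume "x \<in> carrier ?P"
    then obtain u where u: "u \<in> words S" "x = ?c u" by (auto simp: in_carr)
    let ?v = "rev (map (\<lambda>(s, e). (s, \<not> e)) u)"
    have v: "?v \<in> words S" using pres_cong_words[OF pres_inverse[OF u(1)]] by simp
    have "?c ?v \<otimes>\<^bsub>?P\<^esub> x = \<one>\<^bsub>?P\<^esub>"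
      using pres_mult[OF v u(1)] equiv_class_eq[OF equiv_pres_cong pres_inverse[OF u(1)]]
      by (simp add: one u)
    moreover have "?c ?v \<in> carrier ?P" using v unfolding in_carr by blast
    ultimately show "\<exists>y\<in>carrier ?P. y \<otimes>\<^bsub>?P\<^esub> x = \<one>\<^bsub>?P\<^esub>" by blast
  qed (auto simp: in_carr one pres_mult)
qed

section \<open>Coxeter systems\<close>

definition coxeter_matrix :: "'s set \<Rightarrow> ('s \<Rightarrow> 's \<Rightarrow> enat) \<Rightarrow> bool" where
  "coxeter_matrix S m \<longleftrightarrow>
    (\<forall>s\<in>S. \<forall>t\<in>S. m s t = m t s \<and> (if s = t then m s t = 1 else m s t \<ge> 2))"

definition coxeter_relations ::
    "'s set \<Rightarrow> ('s \<Rightarrow> 's \<Rightarrow> enat) \<Rightarrow> ('s word \<times> 's word) set" where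
  "coxeter_relations S m =
    {(concat (replicate k [(s, True), (t, True)]), []) | s t k. s \<in> S \<and> t \<in> S \<and> m s t = enat k}"

definition coxeter_system :: "('w, 'm) monoid_scheme \<Rightarrow> 'w set \<Rightarrow> bool" where
  "coxeter_system W S \<longleftrightarrow> group W \<and> S \<subseteq> carrier W \<and>
    (\<exists>m. coxeter_matrix S m \<and>
      (\<exists>\<phi> \<in> iso (presented_group S (coxeter_relations S m)) W.
        \<forall>s\<in>S. \<phi> (pres_gen S (coxeter_relations S m) s) = s))"

section \<open>Reflections and reflection length\<close>

definition reflections :: "('w, 'm) monoid_scheme \<Rightarrow> 'w set \<Rightarrow> 'w set" where
  "reflections G S = {w \<otimes>\<^bsub>G\<^esub> s \<otimes>\<^bsub>G\<^esub> inv\<^bsub>G\<^esub> w | w s. w \<in> carrier G \<and> s \<in> S}"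

definition tuple_prod :: "('w, 'm) monoid_scheme \<Rightarrow> 'w list \<Rightarrow> 'w" where
  "tuple_prod G ts = foldr (\<otimes>\<^bsub>G\<^esub>) ts \<one>\<^bsub>G\<^esub>"

definition refl_length :: "('w, 'm) monoid_scheme \<Rightarrow> 'w set \<Rightarrow> 'w \<Rightarrow> nat" where
  "refl_length G T w = (LEAST r. \<exists>ts. length ts = r \<and> set ts \<subseteq> T \<and> tuple_prod G ts = w)"

definition Red :: "('w, 'm) monoid_scheme \<Rightarrow> 'w set \<Rightarrow> 'w \<Rightarrow> 'w list set" where
  "Red G T c = {ts. length ts = refl_length G T c \<and> set ts \<subseteq> T \<and> tuple_prod G ts = c}"

section \<open>The braid group and the Hurwitz action\<close>

definition braid_relations :: "nat \<Rightarrow> (nat word \<times> nat word) set" where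
  "braid_relations n =
    {([(i, True), (Suc i, True), (i, True)], [(Suc i, True), (i, True), (Suc i, True)]) | i.
       1 \<le> i \<and> Suc i < n} \<union>
    {([(i, True), (j, True)], [(j, True), (i, True)]) | i j. 1 \<le> i \<and> i + 2 \<le> j \<and> j < n}"

definition braid_group :: "nat \<Rightarrow> nat word set monoid" where
  "braid_group n = presented_group {1..<n} (braid_relations n)"

definition braid_gen :: "nat \<Rightarrow> nat \<Rightarrow> nat word set" where
  "braid_gen n i = pres_gen {1..<n} (braid_relations n) i"

text \<open>Generators are numbered from 1 but list positions from 0, so that \<open>t\<^sub>i\<close> is \<open>ts ! (i - 1)\<close>.\<close>

fun hurwitz_letter :: "('w, 'm) monoid_scheme \<Rightarrow> nat \<times> bool \<Rightarrow> 'w list \<Rightarrow> 'w list" where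
  "hurwitz_letter G (i, True) ts =
     ts[i - 1 := ts ! i, i := inv\<^bsub>G\<^esub> (ts ! i) \<otimes>\<^bsub>G\<^esub> ts ! (i - 1) \<otimes>\<^bsub>G\<^esub> ts ! i]"
| "hurwitz_letter G (i, False) ts =
     ts[i - 1 := ts ! (i - 1) \<otimes>\<^bsub>G\<^esub> ts ! i \<otimes>\<^bsub>G\<^esub> inv\<^bsub>G\<^esub> (ts ! (i - 1)), i := ts ! (i - 1)]"

definition hurwitz_word :: "('w, 'm) monoid_scheme \<Rightarrow> nat word \<Rightarrow> 'w list \<Rightarrow> 'w list" where
  "hurwitz_word G w ts = foldr (hurwitz_letter G) w ts"

lemma hurwitz_letter_length [simp]: "length (hurwitz_letter G a ts) = length ts"
  by (cases "(G, a, ts)" rule: hurwitz_letter.cases) auto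

lemma (in group) hurwitz_letter_set:
  assumes "set ts \<subseteq> carrier G" "fst a \<in> {1..<length ts}"
  shows "set (hurwitz_letter G a ts) \<subseteq> carrier G"
proof -
  have "ts ! (fst a) \<in> carrier G" "ts ! (fst a - 1) \<in> carrier G"
    using assms by (auto intro!: subsetD[OF assms(1)])
  then show ?thesis
    using assms by (cases "(G, a, ts)" rule: hurwitz_letter.cases)
      (auto dest!: subsetD[OF set_update_subset_insert])
qed

lemma (in group) hurwitz_word_tuple:
  assumes "w \<in> words {1..<n}" "length ts = n" "set ts \<subseteq> carrier G"
  shows "length (hurwitz_word G w ts) = n \<and> set (hurwitz_word G w ts) \<subseteq> carrier G"
  using assms
proof (induction w)
  case (Cons a w)
  then show ?case using hurwitz_letter_set[of "hurwitz_word G w ts" a] by (auto simp: hurwitz_word_def)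
qed (simp add: hurwitz_word_def)

lemma hurwitz_word_append: "hurwitz_word G (u @ v) ts = hurwitz_word G u (hurwitz_word G v ts)"
  by (simp add: hurwitz_word_def)

lemma (in group) hurwitz_cancel:
  assumes "i \<in> {1..<length ts}" "set ts \<subseteq> carrier G"
  shows "hurwitz_word G [(i, e), (i, \<not> e)] ts = ts"
proof -
  have c: "ts ! i \<in> carrier G" "ts ! (i - 1) \<in> carrier G"
    using assms by (auto intro!: subsetD[OF assms(2)])
  have i: "i - Suc 0 < length ts" "i < length ts" "i - Suc 0 \<noteq> i" "i \<noteq> i - Suc 0"
    using assms by auto
  show ?thesis
    using c i
    by (cases e; intro nth_equalityI)
      (auto simp: hurwitz_word_def nth_list_update m_assoc[symmetric] inv_solve_right inv_mult_group,
       auto simp: m_assoc)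
qed

lemma (in group) conj_simps:
  assumes "x \<in> carrier G" "y \<in> carrier G"
  shows "x \<otimes> (inv x \<otimes> y) = y" "inv x \<otimes> (x \<otimes> y) = y"
  using assms by (simp_all flip: m_assoc)

lemma (in group) hurwitz_relation:
  assumes "(l, r) \<in> braid_relations n" "length ts = n" "set ts \<subseteq> carrier G"
  shows "hurwitz_word G l ts = hurwitz_word G r ts"
proof -
  have carr: "ts ! i \<in> carrier G" if "i < n" for i using assms that by auto
  show ?thesis using assms(1) unfolding braid_relations_def
  proof (elim UnE CollectE exE conjE)
    fix i assume i: "(l, r) = ([(i, True), (Suc i, True), (i, True)], [(Suc i, True), (i, True), (Suc i, True)])"
      "1 \<le> i" "Suc i < n"
    then obtain k where k: "i = Suc k" by (cases i) auto
    have c: "ts ! k \<in> carrier G" "ts ! Suc k \<in> carrier G" "ts ! Suc (Suc k) \<in> carrier G"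
      using i k by (auto intro!: carr)
    show ?thesis
      using i k c assms(2) by (intro nth_equalityI)
        (auto simp: hurwitz_word_def nth_list_update m_assoc inv_mult_group conj_simps)
  next
    fix i j assume i: "(l, r) = ([(i, True), (j, True)], [(j, True), (i, True)])"
      "1 \<le> i" "i + 2 \<le> j" "j < n"
    then obtain k m where k: "i = Suc k" "j = Suc m" "Suc k < m" by (cases i; cases j) auto
    show ?thesis
      using i k assms(2) by (intro nth_equalityI) (auto simp: hurwitz_word_def nth_list_update)
  qed
qed

lemma (in group) hurwitz_word_cong:
  assumes "(u, v) \<in> pres_cong {1..<n} (braid_relations n)" "length ts = n" "set ts \<subseteq> carrier G"
  shows "hurwitz_word G u ts = hurwitz_word G v ts"
  using assms
proof (induction arbitrary: ts rule: pres_cong.induct)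
  case (cancel x y s e)
  then show ?case
    using hurwitz_word_tuple[of y n ts] hurwitz_cancel[of s "hurwitz_word G y ts" e]
    by (simp add: hurwitz_word_append del: append.simps)
next
  case (relation x y l r)
  then show ?case
    using hurwitz_word_tuple[of y n ts] hurwitz_relation[of l r n "hurwitz_word G y ts"]
    by (simp add: hurwitz_word_append)
qed auto

text \<open>All words representing a braid act in the same way (see \<open>hurwitz_word_cong\<close> above), so the
  image under \<open>the_elem\<close> is a singleton. The restriction to a Hurwitz-invariant set \<open>E\<close> of tuples is
  needed since the elements of \<open>BijGroup E\<close> are extensional functions.\<close>

definition hurwitz_action ::
    "('w, 'm) monoid_scheme \<Rightarrow> 'w list set \<Rightarrow> nat word set \<Rightarrow> 'w list \<Rightarrow> 'w list" where
  "hurwitz_action G E b = (\<lambda>ts\<in>E. the_elem ((\<lambda>w. hurwitz_word G w ts) ` b))"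

lemma (in group) hurwitz_action_class:
  assumes "u \<in> words {1..<n}" "ts \<in> E" "\<And>ts. ts \<in> E \<Longrightarrow> length ts = n \<and> set ts \<subseteq> carrier G"
  shows "hurwitz_action G E (pres_cong {1..<n} (braid_relations n) `` {u}) ts = hurwitz_word G u ts"
proof -
  have "(\<lambda>w. hurwitz_word G w ts) ` (pres_cong {1..<n} (braid_relations n) `` {u}) = {hurwitz_word G u ts}"
    using assms pres_cong.refl[OF assms(1)] hurwitz_word_cong[of u _ n ts]
    by auto
  with assms show ?thesis by (simp add: hurwitz_action_def)
qed

lemma (in group) hurwitz_group_action:
  assumes E: "\<And>ts. ts \<in> E \<Longrightarrow> length ts = n \<and> set ts \<subseteq> carrier G"
    and inv: "\<And>a ts. fst a \<in> {1..<n} \<Longrightarrow> ts \<in> E \<Longrightarrow> hurwitz_letter G a ts \<in> E"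
  shows "group_action (braid_group n) E (hurwitz_action G E)"
proof -
  let ?R = "pres_cong {1..<n} (braid_relations n)"
  let ?h = "hurwitz_action G E"
  have in_carr: "x \<in> carrier (braid_group n) \<longleftrightarrow> (\<exists>u\<in>words {1..<n}. x = ?R `` {u})" for x
    by (auto simp: braid_group_def presented_group_def quotient_def)
  have inE: "hurwitz_word G u ts \<in> E" if "u \<in> words {1..<n}" "ts \<in> E" for u ts
    using that by (induction u) (auto simp: hurwitz_word_def intro!: inv)
  have cl: "?h (?R `` {u}) ts = hurwitz_word G u ts" if "u \<in> words {1..<n}" "ts \<in> E" for u ts
    using hurwitz_action_class that E by blast
  have ext: "?h x \<in> extensional E" for x by (simp add: hurwitz_action_def)
  have bij: "?h x \<in> Bij E" if x: "x \<in> carrier (braid_group n)" for x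
  proof -
    obtain u where u: "u \<in> words {1..<n}" "x = ?R `` {u}" using x unfolding in_carr by blast
    let ?v = "rev (map (\<lambda>(s, e). (s, \<not> e)) u)"
    have r: "(?v @ u, []) \<in> ?R" using pres_inverse[OF u(1)] .
    then have v: "?v \<in> words {1..<n}" using pres_cong_words by force
    have "rev (map (\<lambda>(s, e). (s, \<not> e)) ?v) = u" by (induction u) auto
    with pres_inverse[OF v, where R = "braid_relations n"] have r': "(u @ ?v, []) \<in> ?R" by simp
    have "bij_betw (?h x) E E"
      using hurwitz_word_cong[OF r] hurwitz_word_cong[OF r'] E inE u v
      by (intro bij_betw_byWitness[of E "hurwitz_word G ?v"])
        (auto simp: cl hurwitz_word_append hurwitz_word_def[of _ "[]"] simp del: One_nat_def)
    with ext show ?thesis by (simp add: Bij_def)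
  qed
  have "?h \<in> hom (braid_group n) (BijGroup E)"
  proof (rule homI)
    fix x y assume xy: "x \<in> carrier (braid_group n)" "y \<in> carrier (braid_group n)"
    obtain u v where uv: "u \<in> words {1..<n}" "x = ?R `` {u}" "v \<in> words {1..<n}" "y = ?R `` {v}"
      using xy unfolding in_carr by blast
    have m: "x \<otimes>\<^bsub>braid_group n\<^esub> y = ?R `` {u @ v}"
      using pres_mult uv by (simp add: braid_group_def)
    have "?h (x \<otimes>\<^bsub>braid_group n\<^esub> y) = compose E (?h x) (?h y)"
      by (rule extensionalityI[OF ext compose_extensional])
        (use uv in \<open>simp add: m[unfolded uv] cl inE compose_def hurwitz_word_append del: One_nat_def\<close>)
    then show "?h (x \<otimes>\<^bsub>braid_group n\<^esub> y) = ?h x \<otimes>\<^bsub>BijGroup E\<^esub> ?h y"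
      using bij xy by (simp add: BijGroup_def)
  qed (use bij in \<open>auto simp: BijGroup_def\<close>)
  then show ?thesis
    by (auto intro!: group_action.intro group_hom.intro group_hom_axioms.intro group_BijGroup
        group_presented_group simp: braid_group_def)
qed

lemma (in group) tuple_prod_Cons: "tuple_prod G (a # ts) = a \<otimes> tuple_prod G ts"
  by (simp add: tuple_prod_def)

lemma (in group) tuple_prod_closed: "set ts \<subseteq> carrier G \<Longrightarrow> tuple_prod G ts \<in> carrier G"
  by (induction ts) (simp_all add: tuple_prod_def)

lemma (in group) tuple_prod_append:
  "set us \<subseteq> carrier G \<Longrightarrow> set ts \<subseteq> carrier G \<Longrightarrow>
    tuple_prod G (us @ ts) = tuple_prod G us \<otimes> tuple_prod G ts"
  by (induction us) (simp_all add: tuple_prod_Cons tuple_prod_closed m_assoc,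
      simp add: tuple_prod_def tuple_prod_closed[unfolded tuple_prod_def])

lemma (in group) reflections_carrier: "S \<subseteq> carrier G \<Longrightarrow> reflections G S \<subseteq> carrier G"
  by (auto simp: reflections_def)

lemma (in group) reflections_conj:
  assumes "S \<subseteq> carrier G" "t \<in> reflections G S" "g \<in> carrier G"
  shows "g \<otimes> t \<otimes> inv g \<in> reflections G S"
proof -
  obtain w s where ws: "w \<in> carrier G" "s \<in> S" "t = w \<otimes> s \<otimes> inv w"
    using assms by (auto simp: reflections_def)
  then have "g \<otimes> t \<otimes> inv g = (g \<otimes> w) \<otimes> s \<otimes> inv (g \<otimes> w)"
    using assms by (auto simp: m_assoc inv_mult_group subset_iff)
  with ws assms show ?thesis by (auto simp: reflections_def)
qed

lemma (in group) hurwitz_action_Red: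
  assumes S: "S \<subseteq> carrier G" and n: "n = refl_length G (reflections G S) c"
  shows "group_action (braid_group n) (Red G (reflections G S) c)
    (hurwitz_action G (Red G (reflections G S) c))"
proof (rule hurwitz_group_action)
  fix ts assume "ts \<in> Red G (reflections G S) c"
  with reflections_carrier[OF S] n show "length ts = n \<and> set ts \<subseteq> carrier G"
    by (auto simp: Red_def)
next
  fix a :: "nat \<times> bool" and ts
  assume a: "fst a \<in> {1..<n}" and ts: "ts \<in> Red G (reflections G S) c"
  let ?T = "reflections G S" and ?k = "fst a - 1"
  define x y us vs where "x = ts ! ?k" and "y = ts ! Suc ?k"
    and "us = take ?k ts" and "vs = drop (Suc (Suc ?k)) ts"
  have "Suc ?k < length ts" using a ts n by (auto simp: Red_def)
  then have dec: "ts = us @ x # y # vs"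
    by (simp add: x_def y_def us_def vs_def Cons_nth_drop_Suc)
  have us: "length us = ?k" using \<open>Suc ?k < length ts\<close> by (simp add: us_def)
  have fa: "fst a = Suc (length us)" using a us by auto
  have T: "set us \<subseteq> ?T" "x \<in> ?T" "y \<in> ?T" "set vs \<subseteq> ?T" using ts dec by (auto simp: Red_def)
  then have C: "set us \<subseteq> carrier G" "x \<in> carrier G" "y \<in> carrier G" "set vs \<subseteq> carrier G"
    using reflections_carrier[OF S] by auto
  note tp = tuple_prod_append tuple_prod_Cons tuple_prod_closed
  show "hurwitz_letter G a ts \<in> Red G ?T c"
  proof (cases "snd a")
    case True
    have "hurwitz_letter G a ts = us @ y # (inv y \<otimes> x \<otimes> y) # vs"
      using True fa by (cases a) (simp add: dec list_update_append nth_append)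
    moreover have "inv y \<otimes> x \<otimes> y \<in> ?T" using reflections_conj[OF S T(2), of "inv y"] C by simp
    ultimately show ?thesis using ts T C dec by (auto simp: Red_def tp m_assoc conj_simps)
  next
    case False
    have "hurwitz_letter G a ts = us @ (x \<otimes> y \<otimes> inv x) # x # vs"
      using False fa by (cases a) (simp add: dec list_update_append nth_append)
    moreover have "x \<otimes> y \<otimes> inv x \<in> ?T" using reflections_conj[OF S T(3), of x] C by simp
    ultimately show ?thesis using ts T C dec by (auto simp: Red_def tp m_assoc conj_simps)
  qed
qed

section \<open>Generalized Coxeter data\<close>

locale generalized_coxeter_datum =
  fixes B :: "'v::real_vector \<Rightarrow> 'v \<Rightarrow> real" and \<alpha> :: "nat \<Rightarrow> 'v" and n :: nat
  assumes finite_dimensional: "\<exists>b :: 'v set. finite b \<and> span b = UNIV"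
    and bilinear: "bilinear B"
    and symmetric: "B x y = B y x"
    and non_isotropic: "i \<in> {1..n} \<Longrightarrow> B (\<alpha> i) (\<alpha> i) \<noteq> 0"

definition reflect :: "('v::real_vector \<Rightarrow> 'v \<Rightarrow> real) \<Rightarrow> 'v \<Rightarrow> 'v \<Rightarrow> 'v" where
  "reflect B a x = x - (2 * (B x a / B a a)) *\<^sub>R a"

definition simple_refls :: "('v::real_vector \<Rightarrow> 'v \<Rightarrow> real) \<Rightarrow> (nat \<Rightarrow> 'v) \<Rightarrow> nat \<Rightarrow> ('v \<Rightarrow> 'v) set" where
  "simple_refls B \<alpha> n = (\<lambda>i. reflect B (\<alpha> i)) ` {1..n}"

definition refl_group :: "('v::real_vector \<Rightarrow> 'v \<Rightarrow> real) \<Rightarrow> (nat \<Rightarrow> 'v) \<Rightarrow> nat \<Rightarrow> ('v \<Rightarrow> 'v) monoid" where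
  "refl_group B \<alpha> n =
     (BijGroup UNIV)\<lparr>carrier := generate (BijGroup UNIV) (simple_refls B \<alpha> n)\<rparr>"

lemma (in generalized_coxeter_datum) simple_refls_Bij: "simple_refls B \<alpha> n \<subseteq> carrier (BijGroup UNIV)"
proof -
  have "reflect B (\<alpha> i) (reflect B (\<alpha> i) x) = x" if "i \<in> {1..n}" for i x
    using non_isotropic[OF that]
    by (simp add: reflect_def bilinear_lsub[OF bilinear] bilinear_lmul[OF bilinear]
        algebra_simps flip: scaleR_add_left)
  then show ?thesis
    by (auto simp: simple_refls_def BijGroup_def Bij_def simp del: One_nat_def intro!: involuntory_imp_bij)
qed

lemma (in generalized_coxeter_datum) group_refl_group: "group (refl_group B \<alpha> n)"
  using group.subgroup_imp_group[OF group_BijGroup group.generate_is_subgroup[OF group_BijGroup simple_refls_Bij]]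
  by (simp add: refl_group_def)

lemma (in generalized_coxeter_datum) simple_refls_carrier:
  "simple_refls B \<alpha> n \<subseteq> carrier (refl_group B \<alpha> n)"
  by (auto simp: refl_group_def intro: generate.incl)

end

theory Submission
  imports Defs
begin

text \<open>Project a reduced factorization of \<open>c\<close> to \<open>Wbar\<close>. Since \<open>p\<close> sends both \<open>s\<^sub>n\<^sub>-\<^sub>1\<close> and \<open>s\<^sub>n\<close> to
  the last simple reflection, which is an involution, \<open>c\<close> maps to the product of the first
  \<open>n - 2\<close> simple reflections, while the projected tuple still has \<open>n\<close> entries. A factorization of
  a product of distinct simple reflections that is too long can only be so for a trivial reason: up
  to Hurwitz moves it is the tuple of these simple reflections followed by pairs \<open>t, t\<close>
  (\<open>factorization_hurwitz_equiv\<close>). Counting entries leaves one pair. The moves lift along \<open>p\<close>, so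
  hypothesis (T2) applies: the reflection in the pair is conjugate to the last simple reflection
  under the first \<open>n - 2\<close>. Carrying the pair once around a simple reflection conjugates the pair by
  it and changes nothing else (\<open>hurwitz_equiv_pair_conj\<close>), so the pair can be turned into the last
  simple reflection, twice. Lifting these moves as well, (T3) puts the tuple in the orbit of
  \<open>(s\<^sub>1, \<dots>, s\<^sub>n)\<close>.

  The factorization theorem is a statement about paths in the Bruhat graph of a Coxeter group: a
  tuple of reflections is the path of its partial products. Let the path have a peak, that is, a
  vertex longer than both its neighbours, entered by \<open>t1\<close> and left by \<open>t2\<close>. If \<open>t1 = t2\<close>, this is
  a pair and it can be moved to the end. Otherwise some Hurwitz moves inside the
  dihedral group of \<open>t1\<close> and \<open>t2\<close> lower the peak (\<open>lower_middle_vertex\<close>), so the total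
  length of the vertices drops. A path without peaks starts at the identity and hence
  ascends throughout. When it ends in a product of distinct simple reflections, strong exchange
  says that its last step inserts one missing simple reflection, and induction
  along the path identifies the tuple (\<open>ascending_hurwitz_equiv\<close>).

  Lengths are controlled by the inversion sets \<open>N(g) = {t. g t shorter than g}\<close> and their cocycle
  identity, according to which \<open>t\<close> lies in exactly one of \<open>inv y \<otimes> N(x) \<otimes> y\<close> and \<open>N(y)\<close> if and only
  if it lies in \<open>N(x \<otimes> y)\<close>; they come from the presentation by counting suffixes of words. That a peak
  can be lowered amounts to the fact that two distinct reflections cannot belong to a
  conjugation-closed set of reflections each of which is an inversion of all the others
  (\<open>unique_mutual_inversion\<close>).\<close>

section \<open>Hurwitz equivalence of tuples\<close>

text \<open>The Hurwitz orbit relation is generated by the moves at adjacent entries, written without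
  indices so that embedding in longer tuples and lifting along homomorphisms are inductions on
  rules; \<open>hurwitz_equiv_imp_orbit\<close> below connects it with the braid group action.\<close>

inductive hurwitz_equiv :: "('w, 'm) monoid_scheme \<Rightarrow> 'w list \<Rightarrow> 'w list \<Rightarrow> bool" for G ts where
  refl: "hurwitz_equiv G ts ts"
| right: "hurwitz_equiv G ts (us @ x # y # vs) \<Longrightarrow>
    hurwitz_equiv G ts (us @ y # (inv\<^bsub>G\<^esub> y \<otimes>\<^bsub>G\<^esub> x \<otimes>\<^bsub>G\<^esub> y) # vs)"
| left: "hurwitz_equiv G ts (us @ x # y # vs) \<Longrightarrow>
    hurwitz_equiv G ts (us @ (x \<otimes>\<^bsub>G\<^esub> y \<otimes>\<^bsub>G\<^esub> inv\<^bsub>G\<^esub> x) # x # vs)"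

lemma hurwitz_equiv_trans [trans]:
  assumes "hurwitz_equiv G ts us" "hurwitz_equiv G us vs"
  shows "hurwitz_equiv G ts vs"
  using assms(2,1) by (induction rule: hurwitz_equiv.induct) (auto intro: hurwitz_equiv.intros)

lemma hurwitz_equiv_append:
  assumes "hurwitz_equiv G ts us"
  shows "hurwitz_equiv G (as @ ts @ bs) (as @ us @ bs)"
  using assms
proof (induction rule: hurwitz_equiv.induct)
  case (right us x y vs)
  then show ?case using hurwitz_equiv.right[of G "as @ ts @ bs" "as @ us" x y "vs @ bs"] by simp
next
  case (left us x y vs)
  then show ?case using hurwitz_equiv.left[of G "as @ ts @ bs" "as @ us" x y "vs @ bs"] by simp
qed (rule hurwitz_equiv.refl)

lemma hurwitz_equiv_length: "hurwitz_equiv G ts us \<Longrightarrow> length us = length ts"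
  by (induction rule: hurwitz_equiv.induct) auto

lemma hurwitz_equiv_right: "hurwitz_equiv G (us @ x # y # vs)
    (us @ y # (inv\<^bsub>G\<^esub> y \<otimes>\<^bsub>G\<^esub> x \<otimes>\<^bsub>G\<^esub> y) # vs)"
  by (intro hurwitz_equiv.intros)

lemma hurwitz_equiv_left: "hurwitz_equiv G (us @ x # y # vs)
    (us @ (x \<otimes>\<^bsub>G\<^esub> y \<otimes>\<^bsub>G\<^esub> inv\<^bsub>G\<^esub> x) # x # vs)"
  by (intro hurwitz_equiv.intros)

context group
begin

lemma hurwitz_equiv_carrier:
  assumes "hurwitz_equiv G ts us" "set ts \<subseteq> carrier G"
  shows "set us \<subseteq> carrier G"
  using assms by (induction rule: hurwitz_equiv.induct) auto

lemma hurwitz_equiv_prod: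
  assumes "hurwitz_equiv G ts us" "set ts \<subseteq> carrier G"
  shows "tuple_prod G us = tuple_prod G ts"
  using assms(1)
proof (induction rule: hurwitz_equiv.induct)
  case (right us x y vs)
  then show ?case using hurwitz_equiv_carrier[OF right.hyps assms(2)]
    by (simp add: tuple_prod_append tuple_prod_Cons tuple_prod_closed m_assoc conj_simps)
next
  case (left us x y vs)
  then show ?case using hurwitz_equiv_carrier[OF left.hyps assms(2)]
    by (simp add: tuple_prod_append tuple_prod_Cons tuple_prod_closed m_assoc conj_simps)
qed simp

lemma hurwitz_equiv_reflections:
  assumes "hurwitz_equiv G ts us" "S \<subseteq> carrier G" "set ts \<subseteq> reflections G S"
  shows "set us \<subseteq> reflections G S"
  using assms(1)
proof (induction rule: hurwitz_equiv.induct)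
  case (right us x y vs)
  then show ?case
    using reflections_conj[OF assms(2), of x "inv y"] reflections_carrier[OF assms(2)] by auto
next
  case (left us x y vs)
  then show ?case
    using reflections_conj[OF assms(2), of y x] reflections_carrier[OF assms(2)] by auto
qed (rule assms(3))

lemma hurwitz_equiv_sym:
  assumes "hurwitz_equiv G ts us" "set ts \<subseteq> carrier G"
  shows "hurwitz_equiv G us ts"
  using assms(1)
proof (induction rule: hurwitz_equiv.induct)
  case (right us x y vs)
  have "set (us @ x # y # vs) \<subseteq> carrier G"
    using hurwitz_equiv_carrier[OF right.hyps assms(2)] .
  then have "hurwitz_equiv G (us @ y # (inv y \<otimes> x \<otimes> y) # vs) (us @ x # y # vs)"
    using hurwitz_equiv_left[of G us y "inv y \<otimes> x \<otimes> y" vs] by (simp add: m_assoc conj_simps)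
  then show ?case using right.IH by (rule hurwitz_equiv_trans)
next
  case (left us x y vs)
  have "set (us @ x # y # vs) \<subseteq> carrier G"
    using hurwitz_equiv_carrier[OF left.hyps assms(2)] .
  then have "hurwitz_equiv G (us @ (x \<otimes> y \<otimes> inv x) # x # vs) (us @ x # y # vs)"
    using hurwitz_equiv_right[of G us "x \<otimes> y \<otimes> inv x" x vs] by (simp add: m_assoc conj_simps)
  then show ?case using left.IH by (rule hurwitz_equiv_trans)
qed (rule hurwitz_equiv.refl)

lemma hurwitz_equiv_imp_word:
  assumes "hurwitz_equiv G ts us"
  shows "\<exists>w\<in>words {1..<length ts}. hurwitz_word G w ts = us"
  using assms
proof (induction rule: hurwitz_equiv.induct)
  case refl
  show ?case by (intro bexI[of _ "[]"]) (simp_all add: hurwitz_word_def)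
next
  case (right us x y vs)
  then obtain w where "w \<in> words {1..<length ts}" "hurwitz_word G w ts = us @ x # y # vs" by blast
  with hurwitz_equiv_length[OF right.hyps] show ?case
    by (intro bexI[of _ "(Suc (length us), True) # w"])
      (auto simp: hurwitz_word_def list_update_append nth_append)
next
  case (left us x y vs)
  then obtain w where "w \<in> words {1..<length ts}" "hurwitz_word G w ts = us @ x # y # vs" by blast
  with hurwitz_equiv_length[OF left.hyps] show ?case
    by (intro bexI[of _ "(Suc (length us), False) # w"])
      (auto simp: hurwitz_word_def list_update_append nth_append)
qed

lemma hurwitz_equiv_imp_orbit:
  assumes "\<And>ts. ts \<in> E \<Longrightarrow> length ts = n \<and> set ts \<subseteq> carrier G"
    and "ts \<in> E" "hurwitz_equiv G ts us"
  shows "us \<in> orbit (braid_group n) (hurwitz_action G E) ts"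
proof -
  obtain w where w: "w \<in> words {1..<n}" "hurwitz_word G w ts = us"
    using hurwitz_equiv_imp_word[OF assms(3)] assms(1,2) by auto
  let ?b = "pres_cong {1..<n} (braid_relations n) `` {w}"
  have "?b \<in> carrier (braid_group n)"
    using w(1) by (auto simp: braid_group_def presented_group_def quotient_def simp del: One_nat_def)
  moreover have "hurwitz_action G E ?b ts = us"
    using hurwitz_action_class[OF w(1) assms(2,1)] w(2) by simp
  ultimately show ?thesis unfolding orbit_def by blast
qed

text \<open>Since \<open>t\<close> is an involution, an element passes over the pair \<open>t, t\<close> unchanged.\<close>

lemma hurwitz_equiv_pair_left:
  assumes "set bs \<subseteq> carrier G" "t \<in> carrier G" "t \<otimes> t = \<one>"
  shows "hurwitz_equiv G (bs @ [t, t]) (t # t # bs)"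
  using assms(1)
proof (induction bs)
  case Nil
  show ?case by (simp add: hurwitz_equiv.refl)
next
  case (Cons b bs)
  have "hurwitz_equiv G (b # bs @ [t, t]) (b # t # t # bs)"
    using hurwitz_equiv_append[OF Cons.IH, of "[b]" "[]"] Cons.prems by simp
  also have "hurwitz_equiv G (b # t # t # bs) (t # (inv t \<otimes> b \<otimes> t) # t # bs)"
    using hurwitz_equiv_right[of G "[]"] by simp
  also have "hurwitz_equiv G \<dots> (t # t # (inv t \<otimes> (inv t \<otimes> b \<otimes> t) \<otimes> t) # bs)"
    using hurwitz_equiv_right[of G "[t]"] by simp
  also have "inv t \<otimes> (inv t \<otimes> b \<otimes> t) \<otimes> t = b"
    using Cons.prems assms by (simp add: inv_equality[of t t] m_assoc flip: m_assoc[of t t])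
  finally show ?case by simp
qed

text \<open>Let \<open>s\<close> travel rightwards over the pair, which leaves \<open>s\<close> unchanged; then let both copies of
  \<open>t\<close> travel back over \<open>s\<close>, which conjugates them.\<close>

lemma hurwitz_equiv_pair_conj:
  assumes "set as \<subseteq> carrier G" "s \<in> set as" "t \<in> carrier G" "t \<otimes> t = \<one>"
  shows "hurwitz_equiv G (as @ [t, t]) (as @ [inv s \<otimes> t \<otimes> s, inv s \<otimes> t \<otimes> s])"
proof -
  obtain bs cs where as: "as = bs @ s # cs" using assms(2) by (meson split_list)
  let ?t = "inv s \<otimes> t \<otimes> s"
  have C: "set (s # cs) \<subseteq> carrier G" "set cs \<subseteq> carrier G" "s \<in> carrier G"
    using assms(1) as by auto
  have "?t \<otimes> ?t = inv s \<otimes> (t \<otimes> t) \<otimes> s"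
    using C assms(3) by (simp add: m_assoc conj_simps)
  then have t: "?t \<in> carrier G" "?t \<otimes> ?t = \<one>" using C assms(3,4) by auto
  have "hurwitz_equiv G ((s # cs) @ [t, t]) (t # t # s # cs)"
    using hurwitz_equiv_pair_left[OF C(1) assms(3,4)] .
  also have "hurwitz_equiv G (t # t # s # cs) (t # s # ?t # cs)"
    using hurwitz_equiv_right[of G "[t]"] by simp
  also have "hurwitz_equiv G (t # s # ?t # cs) (s # ?t # ?t # cs)"
    using hurwitz_equiv_right[of G "[]"] by simp
  also have "hurwitz_equiv G (s # ?t # ?t # cs) (s # cs @ [?t, ?t])"
    using hurwitz_equiv_append[OF hurwitz_equiv_sym[OF hurwitz_equiv_pair_left[OF C(2) t]],
        of "[s]" "[]"] C t by simp
  finally show ?thesis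
    using hurwitz_equiv_append[of G "(s # cs) @ [t, t]" "s # cs @ [?t, ?t]" bs "[]"] by (simp add: as)
qed

text \<open>An element at the end of a tuple can travel leftwards unchanged up to conjugation by the
  entries it crosses; with this choice of last entry it arrives as \<open>s\<close>.\<close>

lemma hurwitz_equiv_insert:
  assumes "set bs \<subseteq> carrier G" "s \<in> carrier G"
  shows "hurwitz_equiv G (bs @ [inv (tuple_prod G bs) \<otimes> s \<otimes> tuple_prod G bs]) (s # bs)"
  using assms
proof (induction bs arbitrary: s)
  case Nil
  then show ?case by (simp add: tuple_prod_def hurwitz_equiv.refl)
next
  case (Cons b bs)
  let ?s = "inv b \<otimes> s \<otimes> b"
  have C: "b \<in> carrier G" "?s \<in> carrier G" "tuple_prod G bs \<in> carrier G"
    using Cons.prems by (auto simp: tuple_prod_closed)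
  have "hurwitz_equiv G ([b] @ (bs @ [inv (tuple_prod G bs) \<otimes> ?s \<otimes> tuple_prod G bs]) @ []) ([b] @ (?s # bs) @ [])"
    using Cons.IH[OF _ C(2)] Cons.prems by (intro hurwitz_equiv_append) auto
  also have "hurwitz_equiv G ([b] @ (?s # bs) @ []) ((b \<otimes> ?s \<otimes> inv b) # b # bs)"
    using hurwitz_equiv_left[of G "[]"] by simp
  also have "b \<otimes> ?s \<otimes> inv b = s" using Cons.prems C by (simp add: m_assoc conj_simps)
  finally show ?case using Cons.prems C by (simp add: tuple_prod_Cons inv_mult_group m_assoc)
qed

end

text \<open>Hurwitz moves use only the group operations, so they lift along a homomorphism.\<close>

lemma (in group_hom) hurwitz_equiv_lift:
  assumes "hurwitz_equiv H (map h ts) us" "set ts \<subseteq> carrier G"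
  shows "\<exists>vs. hurwitz_equiv G ts vs \<and> map h vs = us"
  using assms(1)
proof (induction rule: hurwitz_equiv.induct)
  case refl
  show ?case using hurwitz_equiv.refl by blast
next
  case (right us x y vs)
  then obtain us' x' y' vs' where w: "hurwitz_equiv G ts (us' @ x' # y' # vs')"
    and "us = map h us'" "x = h x'" "y = h y'" "vs = map h vs'"
    by (auto simp: map_eq_append_conv map_eq_Cons_conv)
  moreover have "x' \<in> carrier G" "y' \<in> carrier G"
    using G.hurwitz_equiv_carrier[OF w assms(2)] by auto
  ultimately show ?case
    by (intro exI[of _ "us' @ y' # (inv\<^bsub>G\<^esub> y' \<otimes>\<^bsub>G\<^esub> x' \<otimes>\<^bsub>G\<^esub> y') # vs'"])
      (auto intro: hurwitz_equiv.right)
next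
  case (left us x y vs)
  then obtain us' x' y' vs' where w: "hurwitz_equiv G ts (us' @ x' # y' # vs')"
    and "us = map h us'" "x = h x'" "y = h y'" "vs = map h vs'"
    by (auto simp: map_eq_append_conv map_eq_Cons_conv)
  moreover have "x' \<in> carrier G" "y' \<in> carrier G"
    using G.hurwitz_equiv_carrier[OF w assms(2)] by auto
  ultimately show ?case
    by (intro exI[of _ "us' @ (x' \<otimes>\<^bsub>G\<^esub> y' \<otimes>\<^bsub>G\<^esub> inv\<^bsub>G\<^esub> x') # x' # vs'"])
      (auto intro: hurwitz_equiv.left)
qed

section \<open>Inversions and strong exchange in a Coxeter group\<close>

locale coxeter_group = group G for G (structure) +
  fixes S
  assumes coxeter: "coxeter_system G S"
begin

lemma S_carrier: "S \<subseteq> carrier G"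
  using coxeter by (simp add: coxeter_system_def)

lemma prod_closed: "set u \<subseteq> S \<Longrightarrow> tuple_prod G u \<in> carrier G"
  using S_carrier by (intro tuple_prod_closed) auto

text \<open>What is needed of the presentation, in terms of words without exponents: a simple reflection
  is its own inverse, so the exponents of letters can be forgotten.\<close>

lemma presentation:
  obtains m where "coxeter_matrix S m"
    and "\<And>u. u \<in> words S \<Longrightarrow> (u, []) \<in> coxeter_relations S m \<Longrightarrow> tuple_prod G (map fst u) = \<one>"
    and "\<And>s. s \<in> S \<Longrightarrow> s \<otimes> s = \<one>"
    and "\<And>u v. set u \<subseteq> S \<Longrightarrow> set v \<subseteq> S \<Longrightarrow> tuple_prod G u = tuple_prod G v \<Longrightarrow>
      (map (\<lambda>s. (s, True)) u, map (\<lambda>s. (s, True)) v) \<in> pres_cong S (coxeter_relations S m)"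
    and "\<And>g. g \<in> carrier G \<Longrightarrow> \<exists>u. set u \<subseteq> S \<and> tuple_prod G u = g"
proof -
  obtain m \<phi> where m: "coxeter_matrix S m"
    and \<phi>: "\<phi> \<in> iso (presented_group S (coxeter_relations S m)) G"
    and gen: "\<And>s. s \<in> S \<Longrightarrow> \<phi> (pres_gen S (coxeter_relations S m) s) = s"
    using coxeter by (auto simp: coxeter_system_def)
  let ?R = "coxeter_relations S m"
  let ?P = "presented_group S ?R"
  let ?c = "\<lambda>u. pres_cong S ?R `` {u}"
  interpret h: group_hom ?P G \<phi>
    using \<phi> by (intro group_hom.intro group_presented_group is_group group_hom_axioms.intro)
      (simp add: iso_def)
  have carr: "carrier ?P = ?c ` words S"
    by (auto simp: presented_group_def quotient_def)
  have one: "\<phi> (?c []) = \<one>" using h.hom_one by (simp add: presented_group_def)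
  have mult: "\<phi> (?c (u @ v)) = \<phi> (?c u) \<otimes> \<phi> (?c v)" if "u \<in> words S" "v \<in> words S" for u v
    using h.hom_mult[of "?c u" "?c v"] that by (simp add: carr pres_mult)
  have cong: "?c u = ?c v" if "(u, v) \<in> pres_cong S ?R" for u v
    using equiv_class_eq[OF equiv_pres_cong that] .
  have square: "s \<otimes> s = \<one>" if s: "s \<in> S" for s
  proof -
    have "m s s = enat 1" using m s by (simp add: coxeter_matrix_def one_enat_def)
    then have "([(s, True), (s, True)], []) \<in> ?R"
      using s by (auto simp: coxeter_relations_def intro!: exI[of _ s] exI[of _ 1])
    then have "([(s, True), (s, True)], []) \<in> pres_cong S ?R"
      using pres_cong.relation[of "[]" S "[]" "[(s, True), (s, True)]" "[]" ?R] s by simp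
    from cong[OF this] have "\<phi> (?c [(s, True)]) \<otimes> \<phi> (?c [(s, True)]) = \<one>"
      using mult[of "[(s, True)]" "[(s, True)]"] s one by simp
    then show ?thesis using gen[OF s] by (simp add: pres_gen_def)
  qed
  have letter: "\<phi> (?c [(s, e)]) = s" if s: "s \<in> S" for s e
  proof (cases e)
    case True
    then show ?thesis using gen[OF s] by (simp add: pres_gen_def)
  next
    case False
    have "([(s, True), (s, False)], []) \<in> pres_cong S ?R"
      using pres_cong.cancel[of "[]" S "[]" s True] s by simp
    from cong[OF this] have "s \<otimes> \<phi> (?c [(s, False)]) = s \<otimes> s"
      using mult[of "[(s, True)]" "[(s, False)]"] s one gen[OF s] square[OF s]
      by (simp add: pres_gen_def)
    moreover have "\<phi> (?c [(s, False)]) \<in> carrier G" using s by (auto simp: carr)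
    ultimately show ?thesis using s False S_carrier by (auto simp: subset_iff)
  qed
  have val: "\<phi> (?c u) = tuple_prod G (map fst u)" if "u \<in> words S" for u
    using that
  proof (induction u)
    case Nil
    then show ?case by (simp add: one tuple_prod_def)
  next
    case (Cons a u)
    then show ?case using mult[of "[a]" u] letter[of "fst a" "snd a"] by (simp add: tuple_prod_Cons)
  qed
  have w: "map (\<lambda>s. (s, True)) u \<in> words S" if "set u \<subseteq> S" for u
    using that by (induction u) auto
  have fst: "map fst (map (\<lambda>s. (s, True)) u) = u" for u :: "'a list" by (induction u) auto
  show thesis
  proof (rule that[OF m])
    fix u assume u: "u \<in> words S" "(u, []) \<in> ?R"
    then have "(u, []) \<in> pres_cong S ?R" using pres_cong.relation[of "[]" S "[]" u "[]" ?R] by simp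
    from cong[OF this] show "tuple_prod G (map fst u) = \<one>" using val[OF u(1)] one by simp
  next
    fix u v assume uv: "set u \<subseteq> S" "set v \<subseteq> S" "tuple_prod G u = tuple_prod G v"
    then have "\<phi> (?c (map (\<lambda>s. (s, True)) u)) = \<phi> (?c (map (\<lambda>s. (s, True)) v))"
      unfolding val[OF w[OF uv(1)]] val[OF w[OF uv(2)]] fst by simp
    moreover have "inj_on \<phi> (carrier ?P)" using \<phi> by (simp add: iso_def bij_betw_def)
    ultimately have "?c (map (\<lambda>s. (s, True)) u) = ?c (map (\<lambda>s. (s, True)) v)"
      using w[OF uv(1)] w[OF uv(2)] by (auto simp: carr dest: inj_onD)
    then show "(map (\<lambda>s. (s, True)) u, map (\<lambda>s. (s, True)) v) \<in> pres_cong S ?R"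
      using eq_equiv_class[OF _ equiv_pres_cong w[OF uv(2)]] by simp
  next
    fix g assume "g \<in> carrier G"
    then have "g \<in> \<phi> ` carrier ?P" using \<phi> by (simp add: iso_def bij_betw_def)
    then obtain u where "u \<in> words S" "g = \<phi> (?c u)" by (auto simp: carr)
    then show "\<exists>u. set u \<subseteq> S \<and> tuple_prod G u = g"
      using val by (intro exI[of _ "map fst u"]) (auto simp: words_def)
  qed (rule square)
qed

lemma simple_square: "s \<in> S \<Longrightarrow> s \<otimes> s = \<one>"
  using presentation by metis

lemma simple_inv: "s \<in> S \<Longrightarrow> inv s = s"
  using simple_square S_carrier by (auto intro!: inv_equality)

lemma word_exists:
  assumes "g \<in> carrier G"
  obtains u where "set u \<subseteq> S" "tuple_prod G u = g"
  using presentation assms by metis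

text \<open>Each position of a word \<open>u\<close> determines the reflection \<open>inv v \<otimes> s \<otimes> v\<close>, where \<open>s\<close> is the letter
  there and \<open>v\<close> the word to its right; right multiplication by this reflection deletes the letter.
  Only the parity of the number of positions with a given reflection depends on the group
  element alone.\<close>

fun suffix_parity :: "'a list \<Rightarrow> 'a \<Rightarrow> bool" where
  "suffix_parity [] t \<longleftrightarrow> False"
| "suffix_parity (s # u) t \<longleftrightarrow>
    (t = inv (tuple_prod G u) \<otimes> s \<otimes> tuple_prod G u) \<noteq> suffix_parity u t"

lemma conj_eq_iff:
  assumes "g \<in> carrier G" "x \<in> carrier G" "y \<in> carrier G"
  shows "g \<otimes> x \<otimes> inv g = y \<longleftrightarrow> x = inv g \<otimes> y \<otimes> g"
  using assms by (auto simp: m_assoc conj_simps)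

text \<open>The suffix reflections of \<open>u @ v\<close> are those of \<open>v\<close> and those of \<open>u\<close> conjugated by the value
  of \<open>v\<close>.\<close>

lemma suffix_parity_append:
  assumes "set u \<subseteq> S" "set v \<subseteq> S" "t \<in> carrier G"
  shows "suffix_parity (u @ v) t \<longleftrightarrow>
    suffix_parity u (tuple_prod G v \<otimes> t \<otimes> inv (tuple_prod G v)) \<noteq> suffix_parity v t"
  using assms(1)
proof (induction u)
  case (Cons s u)
  then have C: "set u \<subseteq> carrier G" "set v \<subseteq> carrier G" "s \<in> carrier G"
      "tuple_prod G u \<in> carrier G" "tuple_prod G v \<in> carrier G"
    using S_carrier assms(2) prod_closed by auto
  then have "t = inv (tuple_prod G (u @ v)) \<otimes> s \<otimes> tuple_prod G (u @ v) \<longleftrightarrow>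
      tuple_prod G v \<otimes> t \<otimes> inv (tuple_prod G v) = inv (tuple_prod G u) \<otimes> s \<otimes> tuple_prod G u"
    using assms(3) by (subst conj_eq_iff) (auto simp: tuple_prod_append inv_mult_group m_assoc)
  with Cons show ?case by auto
qed simp

text \<open>Conjugation by \<open>t\<close> is an endomorphism and inverts \<open>d\<close>, hence inverts every power of \<open>d\<close>.\<close>

lemma inverting_involution_pow:
  assumes "t \<in> carrier G" "d \<in> carrier G" "t \<otimes> t = \<one>" "t \<otimes> d \<otimes> t = inv d"
  shows "d [^] (k::int) \<otimes> t = t \<otimes> d [^] (- k)"
proof -
  interpret conj: group_hom G G "\<lambda>x. t \<otimes> x \<otimes> t"
  proof (intro group_hom.intro is_group group_hom_axioms.intro homI)
    fix x y assume "x \<in> carrier G" "y \<in> carrier G"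
    moreover have "t \<otimes> (t \<otimes> y') = y'" if "y' \<in> carrier G" for y'
      using assms that by (simp flip: m_assoc)
    ultimately show "t \<otimes> (x \<otimes> y) \<otimes> t = t \<otimes> x \<otimes> t \<otimes> (t \<otimes> y \<otimes> t)"
      using assms by (simp add: m_assoc)
  qed (use assms in simp)
  have "t \<otimes> d [^] k \<otimes> t = d [^] (- k)"
    using conj.hom_int_pow[of d k] assms by (simp add: int_pow_inv int_pow_neg)
  then have "t \<otimes> (t \<otimes> d [^] k \<otimes> t) = t \<otimes> d [^] (- k)" by simp
  then show ?thesis using assms by (simp flip: m_assoc)
qed

text \<open>The suffix reflections of an alternating word, read from the right, are
  \<open>t\<close>, \<open>t d\<close>, \<open>t d\<^sup>2\<close>, and so on, with \<open>d = s \<otimes> t\<close>.\<close>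

lemma suffix_parity_alternating:
  assumes st: "s \<in> S" "t \<in> S" and x: "x \<in> carrier G"
  shows "tuple_prod G (concat (replicate k [s, t])) = (s \<otimes> t) [^] int k \<and>
    (suffix_parity (concat (replicate k [s, t])) x \<longleftrightarrow>
      odd (\<Sum>j<k + k. of_bool (x = t \<otimes> (s \<otimes> t) [^] int j) :: nat))"
proof (induction k)
  case 0
  then show ?case by (simp add: tuple_prod_def)
next
  case (Suc k)
  let ?d = "s \<otimes> t"
  have C: "s \<in> carrier G" "t \<in> carrier G" using st S_carrier by auto
  have tt: "t \<otimes> t = \<one>" "inv t = t" "inv s = s" using simple_square simple_inv st by auto
  have "t \<otimes> ?d \<otimes> t = inv ?d" using C tt by (simp add: inv_mult_group m_assoc)
  note pow = inverting_involution_pow[OF C(2) _ tt(1) this]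
  have neg: "inv (?d [^] int k) \<otimes> t = t \<otimes> ?d [^] int k"
    using pow[of "- int k"] C by (simp add: int_pow_neg)
  have "inv (?d [^] int k) \<otimes> t \<otimes> ?d [^] int k = t \<otimes> ?d [^] int (k + k)"
    using C by (simp add: neg m_assoc flip: int_pow_mult)
  moreover have "inv (t \<otimes> ?d [^] int k) \<otimes> s \<otimes> (t \<otimes> ?d [^] int k) = t \<otimes> ?d [^] int (Suc (k + k))"
  proof -
    have "inv (t \<otimes> ?d [^] int k) \<otimes> s \<otimes> (t \<otimes> ?d [^] int k) =
        (inv (?d [^] int k) \<otimes> t) \<otimes> (?d \<otimes> ?d [^] int k)"
      using C tt by (simp add: inv_mult_group m_assoc)
    also have "\<dots> = t \<otimes> (?d [^] int k \<otimes> (?d [^] (1::int) \<otimes> ?d [^] int k))"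
      unfolding neg using C by (simp add: m_assoc)
    also have "\<dots> = t \<otimes> ?d [^] int (Suc (k + k))"
      using C int_pow_mult[of ?d 1 "int k"] int_pow_mult[of ?d "int k" "1 + int k"]
      by (simp add: algebra_simps)
    finally show ?thesis .
  qed
  moreover have "?d [^] int (Suc k) = s \<otimes> (t \<otimes> ?d [^] int k)"
    using C int_pow_mult[of ?d 1 "int k"] by (simp add: m_assoc)
  moreover have "odd (\<Sum>j<Suc k + Suc k. of_bool (P j) :: nat) \<longleftrightarrow>
      (P (Suc (k + k)) \<noteq> (P (k + k) \<noteq> odd (\<Sum>j<k + k. of_bool (P j) :: nat)))" for P
    by (cases "P (k + k)"; cases "P (Suc (k + k))") (simp_all del: sum_of_bool_eq)
  ultimately show ?case using Suc.IH
    by (simp only: replicate_Suc concat.simps append.simps suffix_parity.simps tuple_prod_Cons)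
qed

text \<open>If \<open>d\<close> has order dividing \<open>k\<close>, the sequence \<open>t d\<^sup>j\<close> repeats after \<open>k\<close> steps, so every
  reflection occurs an even number of times among the \<open>2 * k\<close> suffix reflections.\<close>

lemma suffix_parity_relator:
  assumes "s \<in> S" "t \<in> S" "x \<in> carrier G"
    and "tuple_prod G (concat (replicate k [s, t])) = \<one>"
  shows "\<not> suffix_parity (concat (replicate k [s, t])) x"
proof -
  let ?f = "\<lambda>j. of_bool (x = t \<otimes> (s \<otimes> t) [^] int j) :: nat"
  have C: "s \<otimes> t \<in> carrier G" using assms S_carrier by auto
  have "(s \<otimes> t) [^] int k = \<one>" using suffix_parity_alternating[OF assms(1-3), of k] assms(4) by simp
  then have "(s \<otimes> t) [^] int (j + k) = (s \<otimes> t) [^] int j" for j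
    using C int_pow_mult[of "s \<otimes> t" "int j" "int k"] by simp
  then have "(\<Sum>j<k + k. ?f j) = (\<Sum>j<k. ?f j) + (\<Sum>j<k. ?f j)"
    using sum.atLeastLessThan_concat[of 0 k "k + k" ?f] sum.shift_bounds_nat_ivl[of ?f 0 k k]
    by (simp add: atLeast0LessThan)
  then show ?thesis using suffix_parity_alternating[OF assms(1-3), of k] by simp
qed

text \<open>Equal elements are related by inserting and deleting relators and squares of letters. These
  have value \<open>\<one>\<close> and even parities, so neither value nor parities change.\<close>

lemma suffix_parity_cong:
  assumes u: "set u \<subseteq> S" and v: "set v \<subseteq> S" and eq: "tuple_prod G u = tuple_prod G v"
    and t: "t \<in> carrier G"
  shows "suffix_parity u t \<longleftrightarrow> suffix_parity v t"
proof -
  obtain m where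
    rel: "\<And>u. u \<in> words S \<Longrightarrow> (u, []) \<in> coxeter_relations S m \<Longrightarrow> tuple_prod G (map fst u) = \<one>"
    and cong: "\<And>u v. set u \<subseteq> S \<Longrightarrow> set v \<subseteq> S \<Longrightarrow> tuple_prod G u = tuple_prod G v \<Longrightarrow>
      (map (\<lambda>s. (s, True)) u, map (\<lambda>s. (s, True)) v) \<in> pres_cong S (coxeter_relations S m)"
    using presentation by metis
  have set: "set (map fst u) \<subseteq> S" if "u \<in> words S" for u
    using that by (auto simp: words_def)
  \<comment> \<open>A factor \<open>r\<close> with trivial value and even parities can be dropped.\<close>
  have drop: "tuple_prod G (map fst (x @ r @ y)) = tuple_prod G (map fst (x @ y)) \<and>
      (\<forall>t\<in>carrier G. suffix_parity (map fst (x @ r @ y)) t = suffix_parity (map fst (x @ y)) t)"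
    if "x \<in> words S" "y \<in> words S" "r \<in> words S" and one: "tuple_prod G (map fst r) = \<one>"
      and none: "\<forall>t\<in>carrier G. \<not> suffix_parity (map fst r) t" for x y r
  proof -
    have C: "tuple_prod G (map fst z) \<in> carrier G" "set (map fst z) \<subseteq> carrier G" if "z \<in> words S" for z
      using that prod_closed[OF set[OF that]] set[OF that] S_carrier by auto
    have "tuple_prod G (map fst r @ map fst y) = tuple_prod G (map fst y)"
      using C that(2,3) one by (simp add: tuple_prod_append)
    then show ?thesis
      using that C[OF that(1)] C[OF that(2)] C[OF that(3)] set[of x] set[of y] set[of r]
      by (auto simp: tuple_prod_append suffix_parity_append)
  qed
  have inv: "tuple_prod G (map fst u) = tuple_prod G (map fst v) \<and>
      (\<forall>t\<in>carrier G. suffix_parity (map fst u) t = suffix_parity (map fst v) t)"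
    if "(u, v) \<in> pres_cong S (coxeter_relations S m)" for u v
    using that
  proof (induction rule: pres_cong.induct)
    case (cancel x y s e)
    then have "s \<in> carrier G" "s \<otimes> s = \<one>" "inv s = s"
      using S_carrier simple_square simple_inv by auto
    then show ?case using cancel drop[of x y "[(s, e), (s, \<not> e)]"]
      by (simp add: tuple_prod_def)
  next
    case (relation x y l r)
    then obtain s t k where l: "l = concat (replicate k [(s, True), (t, True)])" and r: "r = []"
      and st: "s \<in> S" "t \<in> S" by (auto simp: coxeter_relations_def)
    have fst: "map fst l = concat (replicate k [s, t])" by (simp add: l map_concat)
    have one: "tuple_prod G (map fst l) = \<one>" using rel relation r by simp
    then show ?case using drop[of x y l] relation suffix_parity_relator[OF st, of _ k]
      by (simp add: r fst)
  qed auto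
  have "map fst (map (\<lambda>s. (s, True)) u) = u" for u :: "'a list" by (induction u) auto
  then show ?thesis using inv[OF cong[OF u v eq]] t by metis
qed

text \<open>The right inversions of \<open>g\<close>; by \<open>inversions_word\<close> below the choice of word is immaterial.\<close>

definition inversions :: "'a \<Rightarrow> 'a set" where
  "inversions g = {t \<in> carrier G. \<exists>u. set u \<subseteq> S \<and> tuple_prod G u = g \<and> suffix_parity u t}"

lemma inversions_subset: "inversions g \<subseteq> carrier G"
  by (auto simp: inversions_def)

lemma inversions_word:
  assumes "set u \<subseteq> S" "t \<in> carrier G"
  shows "t \<in> inversions (tuple_prod G u) \<longleftrightarrow> suffix_parity u t"
  using assms suffix_parity_cong unfolding inversions_def by blast

lemma inversions_mult:
  assumes "x \<in> carrier G" "y \<in> carrier G" "t \<in> carrier G"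
  shows "t \<in> inversions (x \<otimes> y) \<longleftrightarrow> (y \<otimes> t \<otimes> inv y \<in> inversions x) \<noteq> (t \<in> inversions y)"
proof -
  obtain u v where u: "set u \<subseteq> S" "tuple_prod G u = x" and v: "set v \<subseteq> S" "tuple_prod G v = y"
    using word_exists assms by metis
  have eq: "x \<otimes> y = tuple_prod G (u @ v)"
    using u v S_carrier by (subst tuple_prod_append) auto
  have "t \<in> inversions (tuple_prod G (u @ v)) \<longleftrightarrow>
      (tuple_prod G v \<otimes> t \<otimes> inv (tuple_prod G v) \<in> inversions (tuple_prod G u)) \<noteq>
      (t \<in> inversions (tuple_prod G v))"
    using u(1) v(1) assms(3) prod_closed[OF v(1)]
    by (subst (1 2 3) inversions_word) (simp_all only: suffix_parity_append set_append m_closed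
        inv_closed Un_least not_False_eq_True)
  then show ?thesis by (simp only: eq u(2) v(2))
qed

lemma inversions_simple:
  assumes "s \<in> S"
  shows "inversions s = {s}"
proof -
  have s: "s \<in> carrier G" using assms S_carrier by auto
  then have "t \<in> inversions s \<longleftrightarrow> t = s" if "t \<in> carrier G" for t
    using inversions_word[of "[s]" t] assms that by (simp add: tuple_prod_def)
  then show ?thesis using s inversions_subset by blast
qed

lemma inversions_one: "inversions \<one> = {}"
  using inversions_word[of "[]"] inversions_subset[of \<one>] by (auto simp: tuple_prod_def)

text \<open>An inversion is a suffix reflection an odd number of times, hence at least once, and
  multiplication by it deletes a letter there.\<close>

lemma strong_exchange:
  assumes "set u \<subseteq> S" "t \<in> inversions (tuple_prod G u)"
  obtains as s bs where "u = as @ s # bs" "t = inv (tuple_prod G bs) \<otimes> s \<otimes> tuple_prod G bs"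
    "tuple_prod G u \<otimes> t = tuple_prod G (as @ bs)"
proof -
  have t: "t \<in> carrier G" using assms(2) by (simp add: inversions_def)
  then have "suffix_parity u t" using inversions_word assms by blast
  then have "\<exists>as s bs. u = as @ s # bs \<and> t = inv (tuple_prod G bs) \<otimes> s \<otimes> tuple_prod G bs"
  proof (induction u)
    case (Cons s u)
    show ?case
    proof (cases "suffix_parity u t")
      case True
      then obtain as r bs where "u = as @ r # bs" "t = inv (tuple_prod G bs) \<otimes> r \<otimes> tuple_prod G bs"
        using Cons.IH by blast
      then show ?thesis by (intro exI[of _ "s # as"]) auto
    next
      case False
      then show ?thesis using Cons.prems by (intro exI[of _ "[]"]) simp
    qed
  qed simp
  then obtain as s bs where u: "u = as @ s # bs" and eq: "t = inv (tuple_prod G bs) \<otimes> s \<otimes> tuple_prod G bs"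
    by blast
  have C: "s \<in> carrier G" "set as \<subseteq> carrier G" "set bs \<subseteq> carrier G" "s \<otimes> s = \<one>"
    using assms(1) u S_carrier simple_square by auto
  have "tuple_prod G u \<otimes> t = tuple_prod G as \<otimes> ((s \<otimes> s) \<otimes> tuple_prod G bs)"
    using C(1-3) by (simp add: u eq tuple_prod_append tuple_prod_Cons tuple_prod_closed m_assoc conj_simps)
  also have "\<dots> = tuple_prod G (as @ bs)"
    using C by (simp add: tuple_prod_append tuple_prod_closed)
  finally show thesis using that u eq by blast
qed

lemma reflection_carrier: "t \<in> reflections G S \<Longrightarrow> t \<in> carrier G"
  using reflections_carrier[OF S_carrier] by blast

lemma reflection_square:
  assumes "t \<in> reflections G S"
  shows "t \<otimes> t = \<one>"
proof -
  obtain w s where w: "w \<in> carrier G" "s \<in> S" "t = w \<otimes> s \<otimes> inv w"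
    using assms by (auto simp: reflections_def)
  then have "t \<otimes> t = w \<otimes> (s \<otimes> s) \<otimes> inv w" using S_carrier by (auto simp: m_assoc conj_simps subset_iff)
  then show ?thesis using w simple_square by simp
qed

lemma reflection_inv: "t \<in> reflections G S \<Longrightarrow> inv t = t"
  using reflection_square reflection_carrier by (auto intro!: inv_equality)

text \<open>By the cocycle identity the contributions of \<open>w\<close> and \<open>inv w\<close> to \<open>w \<otimes> s \<otimes> inv w\<close> cancel, and
  the one of \<open>s\<close> remains.\<close>

lemma reflection_in_inversions:
  assumes "t \<in> reflections G S"
  shows "t \<in> inversions t"
proof -
  obtain w s where w: "w \<in> carrier G" "s \<in> S" "t = w \<otimes> s \<otimes> inv w"
    using assms by (auto simp: reflections_def)
  have s: "s \<in> carrier G" using w S_carrier by auto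
  have t: "t \<in> carrier G" using w s by simp
  have wt: "inv w \<otimes> t \<otimes> w = s" using w s by (simp add: m_assoc conj_simps)
  have ss: "s \<otimes> s \<otimes> inv s = s" using s by (simp add: m_assoc)
  have "t \<in> inversions t \<longleftrightarrow> (s \<in> inversions (w \<otimes> s)) \<noteq> (t \<in> inversions (inv w))"
    using inversions_mult[of "w \<otimes> s" "inv w" t] w s t wt by simp
  moreover have "s \<in> inversions (w \<otimes> s) \<longleftrightarrow> s \<notin> inversions w"
    using inversions_mult[of w s s] w s ss inversions_simple by simp
  moreover have "(s \<in> inversions w) = (t \<in> inversions (inv w))"
    using inversions_mult[of w "inv w" t] w s t wt inversions_one by simp
  ultimately show ?thesis by simp
qed

definition word_length :: "'a \<Rightarrow> nat" where
  "word_length g = (LEAST k. \<exists>u. set u \<subseteq> S \<and> length u = k \<and> tuple_prod G u = g)"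

lemma word_length_le: "set u \<subseteq> S \<Longrightarrow> word_length (tuple_prod G u) \<le> length u"
  unfolding word_length_def by (rule Least_le) auto

lemma reduced_word_exists:
  assumes "g \<in> carrier G"
  obtains u where "set u \<subseteq> S" "tuple_prod G u = g" "length u = word_length g"
proof -
  have "\<exists>k u. set u \<subseteq> S \<and> length u = k \<and> tuple_prod G u = g"
    using word_exists[OF assms] by metis
  from LeastI_ex[OF this] show thesis using that unfolding word_length_def by blast
qed

lemma inversion_decreases_length:
  assumes "g \<in> carrier G" "t \<in> inversions g"
  shows "word_length (g \<otimes> t) < word_length g"
proof -
  obtain u where u: "set u \<subseteq> S" "tuple_prod G u = g" "length u = word_length g"
    using reduced_word_exists assms by metis
  then obtain as s bs where "u = as @ s # bs" "g \<otimes> t = tuple_prod G (as @ bs)"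
    using strong_exchange[OF u(1)] assms(2) by metis
  then show ?thesis using word_length_le[of "as @ bs"] u by auto
qed

text \<open>If \<open>t\<close> is not an inversion of \<open>g\<close>, it is one of \<open>g \<otimes> t\<close>.\<close>

lemma noninversion_increases_length:
  assumes "g \<in> carrier G" "t \<in> reflections G S" "t \<notin> inversions g"
  shows "word_length g < word_length (g \<otimes> t)"
proof -
  have t: "t \<in> carrier G" "t \<otimes> t = \<one>" "inv t = t"
    using assms reflection_carrier reflection_square reflection_inv by auto
  have "t \<in> inversions (g \<otimes> t)"
    using inversions_mult[of g t t] assms reflection_in_inversions t by (simp add: m_assoc)
  then have "word_length (g \<otimes> t \<otimes> t) < word_length (g \<otimes> t)"
    using assms t by (intro inversion_decreases_length) auto
  then show ?thesis using assms t by (simp add: m_assoc)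
qed

end

section \<open>Removing peaks from paths in the Bruhat graph\<close>

context coxeter_group
begin

text \<open>By induction on a word that conjugates a simple reflection into an element of \<open>D\<close>. If \<open>D\<close>
  contains the first letter \<open>r\<close> of the word, then \<open>D\<close> lies in the inversion set of \<open>r\<close>, which
  is \<open>{r}\<close>. Otherwise conjugation by \<open>r\<close> shortens the word and preserves the hypotheses on \<open>D\<close>,
  because the only inversion that it could create or destroy is \<open>r\<close> itself.\<close>

lemma unique_mutual_inversion_word:
  assumes "set u \<subseteq> S" "s \<in> S"
    and "D \<subseteq> reflections G S"
    and "\<And>x y. x \<in> D \<Longrightarrow> y \<in> D \<Longrightarrow> x \<otimes> y \<otimes> x \<in> D"
    and "\<And>x y. x \<in> D \<Longrightarrow> y \<in> D \<Longrightarrow> y \<in> inversions x"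
    and "tuple_prod G u \<otimes> s \<otimes> inv (tuple_prod G u) \<in> D"
  shows "D = {tuple_prod G u \<otimes> s \<otimes> inv (tuple_prod G u)}"
  using assms(1,3-6)
proof (induction u arbitrary: D)
  case Nil
  have "s \<in> carrier G" using assms(2) S_carrier by auto
  then have eq: "tuple_prod G [] \<otimes> s \<otimes> inv (tuple_prod G []) = s" by (simp add: tuple_prod_def)
  have "s \<in> D" using Nil.prems(5) unfolding eq .
  then have "D \<subseteq> {s}" using Nil.prems(4)[of s] inversions_simple[OF assms(2)] by blast
  with \<open>s \<in> D\<close> show ?case unfolding eq by blast
next
  case (Cons r u)
  let ?g = "tuple_prod G u \<otimes> s \<otimes> inv (tuple_prod G u)"
  let ?t = "tuple_prod G (r # u) \<otimes> s \<otimes> inv (tuple_prod G (r # u))"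
  let ?c = "\<lambda>x. r \<otimes> x \<otimes> r"
  note T = Cons.prems(2) and closed = Cons.prems(3) and mutual = Cons.prems(4) and t = Cons.prems(5)
  have r: "r \<in> S" "r \<in> carrier G" "r \<otimes> r = \<one>" "inv r = r" "inversions r = {r}"
    using Cons.prems(1) S_carrier simple_square simple_inv inversions_simple by auto
  have rr: "r \<otimes> (r \<otimes> x) = x" if "x \<in> carrier G" for x
    using r that by (simp flip: m_assoc)
  have C: "tuple_prod G u \<in> carrier G" "s \<in> carrier G" "?g \<in> carrier G"
    using assms(2) Cons.prems(1) prod_closed S_carrier by auto
  have DC: "x \<in> carrier G" if "x \<in> D" for x using that T reflection_carrier by blast
  have cc: "?c (?c x) = x" if "x \<in> carrier G" for x using that r rr by (simp add: m_assoc)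
  have t_eq: "?t = ?c ?g" using C r by (simp add: tuple_prod_Cons inv_mult_group m_assoc)
  show "D = {?t}"
  proof (cases "r \<in> D")
    case True
    then have "D = {r}" using mutual r(5) by blast
    then show ?thesis using t by (metis singletonD)
  next
    case False
    have conj: "?c x \<otimes> ?c y \<otimes> ?c x = ?c (x \<otimes> y \<otimes> x)" if "x \<in> D" "y \<in> D" for x y
      using r DC[OF that(1)] DC[OF that(2)] rr by (simp add: m_assoc)
    have inv: "?c y \<in> inversions (?c x)" if xy: "x \<in> D" "y \<in> D" for x y
    proof -
      have x: "x \<in> carrier G" "inv x = x" and y: "y \<in> carrier G"
        using xy DC T reflection_inv by auto
      have "r \<noteq> x \<otimes> y \<otimes> x" "y \<noteq> r" using False closed xy by auto
      moreover have "?c y = r \<Longrightarrow> y = r" using cc[OF y] r by (simp add: m_assoc)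
      moreover have "?c y \<in> inversions (r \<otimes> (x \<otimes> r)) \<longleftrightarrow>
          (x \<otimes> y \<otimes> x \<in> inversions r) \<noteq> (?c y \<in> inversions (x \<otimes> r))"
        using inversions_mult[of r "x \<otimes> r" "?c y"] r x y rr by (simp add: inv_mult_group m_assoc)
      moreover have "?c y \<in> inversions (x \<otimes> r) \<longleftrightarrow> (y \<in> inversions x) \<noteq> (?c y \<in> inversions r)"
        using inversions_mult[of x r "?c y"] r x y rr by (simp add: m_assoc)
      moreover have "?c x = r \<otimes> (x \<otimes> r)" using r x by (simp add: m_assoc)
      ultimately show ?thesis using mutual[OF xy] r(5) by auto
    qed
    have "?c ` D = {?g}"
    proof (rule Cons.IH)
      show "set u \<subseteq> S" using Cons.prems(1) by simp
      show "?c ` D \<subseteq> reflections G S"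
        using T reflections_conj[OF S_carrier _ r(2)] r(4) by auto
      show "x \<otimes> y \<otimes> x \<in> ?c ` D" if "x \<in> ?c ` D" "y \<in> ?c ` D" for x y
        using that conj closed by auto
      show "y \<in> inversions x" if "x \<in> ?c ` D" "y \<in> ?c ` D" for x y
        using that inv by blast
      have "?g = ?c ?t" using t_eq cc[OF C(3)] by simp
      then show "?g \<in> ?c ` D" using t by (rule image_eqI)
    qed
    then have "x = ?t" if "x \<in> D" for x
      using cc[OF DC[OF that]] t_eq that by (metis imageI singletonD)
    then show ?thesis using t by blast
  qed
qed

lemma unique_mutual_inversion:
  assumes "D \<subseteq> reflections G S"
    and "\<And>x y. x \<in> D \<Longrightarrow> y \<in> D \<Longrightarrow> x \<otimes> y \<otimes> x \<in> D"
    and "\<And>x y. x \<in> D \<Longrightarrow> y \<in> D \<Longrightarrow> y \<in> inversions x"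
    and "t \<in> D"
  shows "D = {t}"
proof -
  obtain w s where w: "w \<in> carrier G" "s \<in> S" "t = w \<otimes> s \<otimes> inv w"
    using assms(1,4) by (auto simp: reflections_def)
  obtain u where u: "set u \<subseteq> S" "tuple_prod G u = w" using word_exists[OF w(1)] .
  from unique_mutual_inversion_word[OF u(1) w(2) assms(1-3)] assms(4) show ?thesis
    by (simp add: u w(3))
qed

text \<open>The reflections of the dihedral group generated by \<open>t1\<close> and \<open>t2\<close>, numbered so that
  consecutive ones have product \<open>t1 \<otimes> t2\<close>.\<close>

definition dihedral_reflection :: "'a \<Rightarrow> 'a \<Rightarrow> int \<Rightarrow> 'a" where
  "dihedral_reflection t1 t2 k = t1 \<otimes> (t1 \<otimes> t2) [^] k"

context
  fixes t1 t2
  assumes t1: "t1 \<in> reflections G S" and t2: "t2 \<in> reflections G S"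
begin

private abbreviation (input) "f \<equiv> dihedral_reflection t1 t2"
private abbreviation (input) "d \<equiv> t1 \<otimes> t2"

lemma dihedral_carrier: "t1 \<in> carrier G" "t2 \<in> carrier G" "f k \<in> carrier G"
  using t1 t2 reflection_carrier by (auto simp: dihedral_reflection_def)

lemma dihedral_pow: "d [^] (k::int) \<otimes> t1 = t1 \<otimes> d [^] (- k)"
proof (rule inverting_involution_pow)
  show "t1 \<otimes> d \<otimes> t1 = inv d"
    using dihedral_carrier reflection_square[OF t1] reflection_inv[OF t1] reflection_inv[OF t2]
    by (simp add: inv_mult_group flip: m_assoc)
qed (use dihedral_carrier reflection_square[OF t1] in auto)

lemma dihedral_mult: "f i \<otimes> f j = d [^] (j - i)"
proof -
  have "f i \<otimes> f j = t1 \<otimes> (d [^] i \<otimes> t1) \<otimes> d [^] j"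
    using dihedral_carrier by (simp add: dihedral_reflection_def m_assoc)
  also have "\<dots> = (t1 \<otimes> t1) \<otimes> (d [^] (- i) \<otimes> d [^] j)"
    unfolding dihedral_pow using dihedral_carrier by (simp add: m_assoc)
  also have "\<dots> = d [^] (j - i)"
    using dihedral_carrier reflection_square[OF t1] int_pow_mult[of d "- i" j] by simp
  finally show ?thesis .
qed

lemma dihedral_square: "f i \<otimes> f i = \<one>" "inv (f i) = f i"
  using dihedral_mult[of i i] dihedral_carrier by (auto intro: inv_equality)

lemma dihedral_mult_pow: "f i \<otimes> d [^] j = f (i + j)"
  using dihedral_carrier by (simp add: dihedral_reflection_def m_assoc int_pow_mult)

lemma dihedral_conj: "f i \<otimes> f j \<otimes> f i = f (2 * i - j)"
proof -
  have "f i \<otimes> f j \<otimes> f i = f i \<otimes> (f j \<otimes> f i)" using dihedral_carrier by (simp add: m_assoc)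
  then show ?thesis by (simp add: dihedral_mult dihedral_mult_pow algebra_simps)
qed

lemma dihedral_values: "f 0 = t1" "f 1 = t2"
  using dihedral_carrier reflection_square[OF t1]
  by (simp_all add: dihedral_reflection_def flip: m_assoc)

lemma hurwitz_equiv_dihedral:
  "hurwitz_equiv G (us @ t1 # t2 # vs) (us @ f k # f (k + 1) # vs)"
proof (induction k rule: int_induct[where k = 0])
  case base
  then show ?case using dihedral_values by (simp add: hurwitz_equiv.refl)
next
  case (step1 k)
  then show ?case
    using hurwitz_equiv.right[OF step1.IH] by (simp add: dihedral_square dihedral_conj add.commute)
next
  case (step2 k)
  have "hurwitz_equiv G (us @ t1 # t2 # vs) (us @ f (k - 1) # f k # vs)"
    using hurwitz_equiv.left[OF step2.IH] by (simp add: dihedral_square dihedral_conj)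
  then show ?case by simp
qed

lemma dihedral_reflections: "f k \<in> reflections G S"
  using hurwitz_equiv_reflections[OF hurwitz_equiv_dihedral[of "[]" "[]" k] S_carrier] t1 t2 by simp

text \<open>Suppose no dihedral reflection is an inversion of \<open>x\<close> or \<open>x \<otimes> t1 \<otimes> t2\<close>. By the cocycle
  identity none is an inversion of \<open>d = t1 \<otimes> t2\<close>. Left multiplication by \<open>d\<close> carries each
  dihedral reflection to its predecessor, so they all have the same inversions among themselves, and
  hence each is an inversion of every other. Only a single reflection can do that.\<close>

lemma dihedral_inversion_exists:
  assumes ne: "t1 \<noteq> t2" and x: "x \<in> carrier G"
  shows "\<exists>k. f k \<in> inversions x \<or> f k \<in> inversions (x \<otimes> d)"
proof (rule ccontr)
  assume "\<not> ?thesis"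
  then have none: "f k \<notin> inversions x" "f k \<notin> inversions (x \<otimes> d)" for k by auto
  have d: "d = f i \<otimes> f (i + 1)" for i
    using dihedral_mult[of i "i + 1"] dihedral_carrier by simp
  have "d \<otimes> f k \<otimes> inv d = f (k - 2)" for k
  proof -
    have "d \<otimes> f k \<otimes> inv d = f 0 \<otimes> (f 1 \<otimes> f k \<otimes> f 1) \<otimes> f 0"
      unfolding d[of 0] using dihedral_carrier by (simp add: inv_mult_group dihedral_square m_assoc)
    then show ?thesis by (simp add: dihedral_conj)
  qed
  then have nd: "f k \<notin> inversions d" for k
    using inversions_mult[of x d "f k"] none dihedral_carrier x by auto
  have step: "f k \<in> inversions (f (i - 1)) \<longleftrightarrow> f k \<in> inversions (f i)" for i k
  proof -
    have "f (i - 1) = d \<otimes> f i"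
      unfolding d[of "i - 1"] using dihedral_carrier dihedral_square by (simp add: m_assoc)
    then show ?thesis
      using inversions_mult[of d "f i" "f k"] dihedral_carrier nd
      by (simp add: dihedral_square dihedral_conj)
  qed
  have "f k \<in> inversions (f i) \<longleftrightarrow> f k \<in> inversions (f k)" for i k
  proof (induction i rule: int_induct[where k = k])
    case (step1 i)
    then show ?case using step[of k "i + 1"] by simp
  next
    case (step2 i)
    then show ?case using step[of k i] by simp
  qed simp
  then have "range f = {f 0}"
    using reflection_in_inversions[OF dihedral_reflections] dihedral_reflections
    by (intro unique_mutual_inversion) (auto simp: dihedral_conj)
  then have "f 1 = f 0" by blast
  with ne show False by (simp add: dihedral_values)
qed

text \<open>The vertices \<open>x \<otimes> f k\<close> are those that Hurwitz moves can put between \<open>x\<close> and \<open>x \<otimes> t1 \<otimes> t2\<close>.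
  The one found is shorter than the longer of these two.\<close>

lemma lower_middle_vertex:
  assumes ne: "t1 \<noteq> t2" and x: "x \<in> carrier G"
  shows "\<exists>k. word_length (x \<otimes> f k) < max (word_length x) (word_length (x \<otimes> d))"
proof -
  obtain k where "f k \<in> inversions x \<or> f k \<in> inversions (x \<otimes> d)"
    using dihedral_inversion_exists[OF assms] by blast
  then show ?thesis
  proof
    assume "f k \<in> inversions x"
    then show ?thesis using inversion_decreases_length[OF x] by (auto simp: less_max_iff_disj)
  next
    assume "f k \<in> inversions (x \<otimes> d)"
    moreover have "x \<otimes> d \<otimes> f k = x \<otimes> f (k - 1)"
    proof -
      have "d \<otimes> f k = f (k - 1) \<otimes> (f k \<otimes> f k)"
        using dihedral_mult[of "k - 1" k] dihedral_carrier by (simp flip: m_assoc)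
      then show ?thesis using x dihedral_carrier by (simp add: dihedral_square m_assoc)
    qed
    ultimately show ?thesis
      using inversion_decreases_length[of "x \<otimes> d" "f k"] x dihedral_carrier
      by (intro exI[of _ "k - 1"]) (simp add: less_max_iff_disj)
  qed
qed

end

text \<open>A tuple describes the path \<open>\<one>\<close>, \<open>t\<^sub>1\<close>, \<open>t\<^sub>1 \<otimes> t\<^sub>2\<close>, \<open>\<dots>\<close> of its partial products.\<close>

definition ascending :: "'a list \<Rightarrow> bool" where
  "ascending ts \<longleftrightarrow> (\<forall>us t vs. ts = us @ t # vs \<longrightarrow>
    word_length (tuple_prod G us) < word_length (tuple_prod G us \<otimes> t))"

fun path_weight :: "'a \<Rightarrow> 'a list \<Rightarrow> nat" where
  "path_weight x [] = 0"
| "path_weight x (t # ts) = word_length (x \<otimes> t) + path_weight (x \<otimes> t) ts"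

lemma path_weight_append:
  assumes "x \<in> carrier G" "set us \<subseteq> carrier G"
  shows "path_weight x (us @ vs) = path_weight x us + path_weight (x \<otimes> tuple_prod G us) vs"
  using assms by (induction us arbitrary: x)
    (auto simp: tuple_prod_Cons tuple_prod_closed m_assoc, simp add: tuple_prod_def)

lemma word_length_one: "word_length \<one> = 0"
  using word_length_le[of "[]"] by (simp add: tuple_prod_def)

text \<open>The first descent of the path is not its first step, as nothing is shorter than \<open>\<one>\<close>; the
  vertex where it starts is a peak.\<close>

lemma not_ascending_peak:
  assumes "\<not> ascending ts" "set ts \<subseteq> reflections G S"
  obtains us a b vs where "ts = us @ a # b # vs"
    "word_length (tuple_prod G us) < word_length (tuple_prod G us \<otimes> a)"
    "word_length (tuple_prod G us \<otimes> (a \<otimes> b)) < word_length (tuple_prod G us \<otimes> a)"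
proof -
  let ?P = "\<lambda>us. \<exists>t vs. ts = us @ t # vs \<and>
    \<not> word_length (tuple_prod G us) < word_length (tuple_prod G us \<otimes> t)"
  obtain us0 where "?P us0" using assms(1) unfolding ascending_def by blast
  from ex_has_least_nat[of ?P, OF this, of length]
  obtain us where "?P us" and min: "\<And>us'. length us' < length us \<Longrightarrow> \<not> ?P us'"
    by (metis not_le)
  then obtain b vs where ts: "ts = us @ b # vs"
    and b: "\<not> word_length (tuple_prod G us) < word_length (tuple_prod G us \<otimes> b)" by blast
  have C: "set us \<subseteq> carrier G" "b \<in> carrier G" "b \<in> reflections G S"
    using assms(2) ts reflection_carrier by auto
  have down: "word_length (tuple_prod G us \<otimes> b) < word_length (tuple_prod G us)"
    using b noninversion_increases_length[OF tuple_prod_closed[OF C(1)] C(3)]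
      inversion_decreases_length[OF tuple_prod_closed[OF C(1)]] by blast
  then have "us \<noteq> []" by (auto simp: tuple_prod_def word_length_one)
  then obtain us' a where us: "us = us' @ [a]" by (cases us rule: rev_cases) auto
  have a: "tuple_prod G us = tuple_prod G us' \<otimes> a" "a \<in> carrier G" "tuple_prod G us' \<in> carrier G"
    using C us tuple_prod_append[of us' "[a]"] by (auto simp: tuple_prod_def tuple_prod_closed[unfolded tuple_prod_def])
  have "word_length (tuple_prod G us') < word_length (tuple_prod G us' \<otimes> a)"
    using min[of us'] ts us by auto
  moreover have "word_length (tuple_prod G us' \<otimes> (a \<otimes> b)) < word_length (tuple_prod G us' \<otimes> a)"
    using down a C by (simp add: m_assoc)
  ultimately show thesis using that[of us' a b vs] ts us by simp
qed

text \<open>Lowering a peak changes a single vertex of the path, to one of smaller length, so the total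
  length decreases until there is no peak or a peak with two equal steps.\<close>

lemma hurwitz_equiv_ascending_or_pair:
  assumes "set ts \<subseteq> reflections G S"
  shows "(\<exists>us. hurwitz_equiv G ts us \<and> ascending us) \<or>
    (\<exists>us t. hurwitz_equiv G ts (us @ [t, t]))"
  using assms
proof (induction "path_weight \<one> ts" arbitrary: ts rule: less_induct)
  case less
  show ?case
  proof (cases "ascending ts")
    case True
    then show ?thesis using hurwitz_equiv.refl by blast
  next
    case False
    then obtain us a b vs where ts: "ts = us @ a # b # vs"
      and up: "word_length (tuple_prod G us) < word_length (tuple_prod G us \<otimes> a)"
      and down: "word_length (tuple_prod G us \<otimes> (a \<otimes> b)) < word_length (tuple_prod G us \<otimes> a)"
      using not_ascending_peak less.prems by metis
    let ?x = "tuple_prod G us"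
    have T: "a \<in> reflections G S" "b \<in> reflections G S" using less.prems ts by auto
    have C: "set us \<subseteq> carrier G" "set vs \<subseteq> carrier G" "?x \<in> carrier G" "a \<in> carrier G" "b \<in> carrier G"
      using less.prems ts reflection_carrier by (auto intro!: tuple_prod_closed)
    show ?thesis
    proof (cases "a = b")
      case True
      have "hurwitz_equiv G (us @ (a # a # vs) @ []) (us @ (vs @ [a, a]) @ [])"
        using C T reflection_square
        by (intro hurwitz_equiv_append hurwitz_equiv_sym[OF hurwitz_equiv_pair_left]) auto
      then have "hurwitz_equiv G ts ((us @ vs) @ [a, a])" using ts True by simp
      then show ?thesis by blast
    next
      case False
      obtain k where k: "word_length (?x \<otimes> dihedral_reflection a b k) <
          max (word_length ?x) (word_length (?x \<otimes> (a \<otimes> b)))"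
        using lower_middle_vertex[OF T False C(3)] by blast
      let ?a = "dihedral_reflection a b k" and ?b = "dihedral_reflection a b (k + 1)"
      let ?ts = "us @ ?a # ?b # vs"
      have eq: "hurwitz_equiv G ts ?ts" using hurwitz_equiv_dihedral[OF T] ts by simp
      have "?a \<otimes> ?b = a \<otimes> b" using dihedral_mult[OF T, of k "k + 1"] C by simp
      moreover have "?a \<in> carrier G" "?b \<in> carrier G" using dihedral_carrier[OF T] by auto
      ultimately have "path_weight \<one> ?ts < path_weight \<one> ts"
        using C k up down by (simp add: ts path_weight_append m_assoc)
      moreover have "set ?ts \<subseteq> reflections G S"
        using hurwitz_equiv_reflections[OF eq S_carrier less.prems] .
      ultimately show ?thesis using less.hyps[of ?ts] hurwitz_equiv_trans[OF eq] by blast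
    qed
  qed
qed

end

section \<open>Reflection factorizations of products of distinct simple reflections\<close>

context coxeter_group
begin

text \<open>If the word \<open>u = v @ [r]\<close> had value \<open>s\<close>, then \<open>v\<close> would have value \<open>s \<otimes> r\<close>, of which \<open>r\<close> is an
  inversion. Exchange then deletes a letter of \<open>v\<close> and gives a shorter word without \<open>s\<close> for
  \<open>s\<close>.\<close>

lemma simple_notin_parabolic:
  assumes "s \<in> S" "set u \<subseteq> S - {s}"
  shows "tuple_prod G u \<noteq> s"
  using assms(2)
proof (induction u rule: length_induct)
  case (1 u)
  show ?case
  proof (cases u rule: rev_cases)
    case Nil
    then show ?thesis
      using inversions_simple[OF assms(1)] inversions_one by (auto simp: tuple_prod_def)
  next
    case (snoc v r)
    have r: "r \<in> S" "r \<noteq> s" "r \<in> carrier G" "r \<otimes> r = \<one>" "inv r = r" and s: "s \<in> carrier G"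
      and v: "set v \<subseteq> S" "set v \<subseteq> carrier G"
      using 1(2) snoc assms(1) S_carrier simple_square simple_inv by auto
    note vC = prod_closed[OF v(1)]
    show ?thesis
    proof
      assume "tuple_prod G u = s"
      then have "tuple_prod G v \<otimes> r = s"
        using snoc r v vC by (simp add: tuple_prod_append) (simp add: tuple_prod_def)
      then have v_eq: "tuple_prod G v = s \<otimes> r" using r vC by (auto simp: m_assoc)
      have "r \<in> inversions (s \<otimes> r)"
        using inversions_mult[of s r r] r s inversions_simple[OF r(1)] inversions_simple[OF assms(1)]
        by (simp add: m_assoc)
      then obtain as x bs where "v = as @ x # bs" "tuple_prod G v \<otimes> r = tuple_prod G (as @ bs)"
        using strong_exchange[OF v(1), of r] v_eq by metis
      moreover have "tuple_prod G v \<otimes> r = s" by fact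
      ultimately show False using 1 snoc by auto
    qed
  qed
qed

lemma distinct_prod_one:
  assumes "distinct u" "set u \<subseteq> S" "tuple_prod G u = \<one>"
  shows "u = []"
proof (cases u rule: rev_cases)
  case (snoc v s)
  have s: "s \<in> S" "s \<in> carrier G" and v: "set v \<subseteq> S - {s}" "set v \<subseteq> carrier G"
    using assms snoc S_carrier by auto
  note vC = tuple_prod_closed[OF v(2)]
  have "tuple_prod G v \<otimes> s = \<one>"
    using assms(3) snoc s v vC by (simp add: tuple_prod_append) (simp add: tuple_prod_def)
  then have "tuple_prod G v = s" using s vC simple_inv inv_equality by metis
  then show ?thesis using simple_notin_parabolic[OF s(1) v(1)] by blast
qed

text \<open>The last step \<open>t\<close> ascends, so strong exchange deletes one letter \<open>s\<close> from \<open>ss\<close> to express the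
  product before it. The remaining word again has distinct letters, and \<open>t\<close> is exactly the reflection
  that travels leftwards into the place of \<open>s\<close>, arriving as \<open>s\<close>.\<close>

lemma ascending_hurwitz_equiv:
  assumes "distinct ss" "set ss \<subseteq> S" "set ts \<subseteq> reflections G S" "ascending ts"
    "tuple_prod G ts = tuple_prod G ss"
  shows "hurwitz_equiv G ts ss"
  using assms
proof (induction ts arbitrary: ss rule: rev_induct)
  case Nil
  then have "ss = []" by (intro distinct_prod_one) (auto simp: tuple_prod_def)
  then show ?case by (simp add: hurwitz_equiv.refl)
next
  case (snoc t ts)
  have t: "t \<in> reflections G S" "t \<in> carrier G" "t \<otimes> t = \<one>"
    and ts: "set ts \<subseteq> carrier G" "tuple_prod G ts \<in> carrier G"
    using snoc.prems(3) reflection_carrier reflection_square tuple_prod_closed[of ts] by auto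
  have asc: "ascending ts" using snoc.prems(4) by (auto simp: ascending_def)
  have up: "word_length (tuple_prod G ts) < word_length (tuple_prod G ts \<otimes> t)"
    using snoc.prems(4) by (auto simp: ascending_def)
  have prod: "tuple_prod G ss = tuple_prod G ts \<otimes> t"
    using snoc.prems(5)[symmetric] t ts by (simp add: tuple_prod_append) (simp add: tuple_prod_def)
  then have ts_eq: "tuple_prod G ss \<otimes> t = tuple_prod G ts" using t ts by (simp add: m_assoc)
  have "t \<in> inversions (tuple_prod G ss)"
    using noninversion_increases_length[of "tuple_prod G ss" t] up prod ts_eq t ts by fastforce
  then obtain as s bs where ss: "ss = as @ s # bs"
    and t_eq: "t = inv (tuple_prod G bs) \<otimes> s \<otimes> tuple_prod G bs"
    and eq: "tuple_prod G ss \<otimes> t = tuple_prod G (as @ bs)"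
    using strong_exchange[OF snoc.prems(2)] by metis
  have "hurwitz_equiv G ts (as @ bs)"
    using snoc.prems ss asc eq ts_eq by (intro snoc.IH) auto
  then have "hurwitz_equiv G ([] @ ts @ [t]) ([] @ (as @ bs) @ [t])" by (rule hurwitz_equiv_append)
  also have "hurwitz_equiv G (as @ (bs @ [t]) @ []) (as @ (s # bs) @ [])"
    unfolding t_eq using snoc.prems(2) ss S_carrier
    by (intro hurwitz_equiv_append hurwitz_equiv_insert) auto
  then have "hurwitz_equiv G ([] @ (as @ bs) @ [t]) ss" using ss by simp
  finally show ?case by simp
qed

text \<open>A peak-free path is settled by \<open>ascending_hurwitz_equiv\<close>; otherwise a pair splits off, which
  does not contribute to the product, and the rest is a shorter factorization.\<close>

theorem factorization_hurwitz_equiv: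
  assumes "distinct ss" "set ss \<subseteq> S" "set ts \<subseteq> reflections G S"
    "tuple_prod G ts = tuple_prod G ss"
  obtains ps where "hurwitz_equiv G ts (ss @ concat (map (\<lambda>t. [t, t]) ps))"
proof -
  have "\<exists>ps. hurwitz_equiv G ts (ss @ concat (map (\<lambda>t. [t, t]) ps))"
    using assms(3,4)
  proof (induction ts rule: length_induct)
    case (1 ts)
    have tsC: "set ts \<subseteq> carrier G" using 1(2) reflection_carrier by auto
    from hurwitz_equiv_ascending_or_pair[OF 1(2)] show ?case
    proof (elim disjE exE conjE)
      fix us assume us: "hurwitz_equiv G ts us" "ascending us"
      have "hurwitz_equiv G us ss"
        using hurwitz_equiv_reflections[OF us(1) S_carrier 1(2)] hurwitz_equiv_prod[OF us(1) tsC]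
          us(2) assms(1,2) 1(3) by (intro ascending_hurwitz_equiv) auto
      then have "hurwitz_equiv G ts ss" using us(1) hurwitz_equiv_trans by metis
      then show ?case by (intro exI[of _ "[]"]) simp
    next
      fix us t assume us: "hurwitz_equiv G ts (us @ [t, t])"
      have T: "set us \<subseteq> reflections G S" "t \<in> reflections G S"
        using hurwitz_equiv_reflections[OF us S_carrier 1(2)] by auto
      then have "set us \<subseteq> carrier G" "t \<in> carrier G" "t \<otimes> t = \<one>"
        using reflection_carrier reflection_square by auto
      then have "tuple_prod G (us @ [t, t]) = tuple_prod G us"
        by (simp add: tuple_prod_append tuple_prod_closed) (simp add: tuple_prod_def tuple_prod_closed[unfolded tuple_prod_def])
      then have "tuple_prod G us = tuple_prod G ss" using hurwitz_equiv_prod[OF us tsC] 1(3) by simp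
      moreover have "length us < length ts" using hurwitz_equiv_length[OF us] by simp
      ultimately obtain ps where "hurwitz_equiv G us (ss @ concat (map (\<lambda>t. [t, t]) ps))"
        using 1(1) T by blast
      from hurwitz_equiv_append[OF this, of "[]" "[t, t]"]
      have "hurwitz_equiv G (us @ [t, t]) (ss @ concat (map (\<lambda>t. [t, t]) (ps @ [t])))" by simp
      then show ?case using us hurwitz_equiv_trans by metis
    qed
  qed
  then show thesis using that by blast
qed

lemma hurwitz_equiv_pair_conj_generate:
  assumes "set ss \<subseteq> S" "w \<in> generate G (set ss)" "t \<in> carrier G" "t \<otimes> t = \<one>"
  shows "hurwitz_equiv G (ss @ [t, t]) (ss @ [w \<otimes> t \<otimes> inv w, w \<otimes> t \<otimes> inv w])"
proof -
  have ssC: "set ss \<subseteq> carrier G" using assms(1) S_carrier by auto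
  show ?thesis using assms(2-4)
  proof (induction w arbitrary: t rule: generate.induct)
    case one
    then show ?case by (simp add: hurwitz_equiv.refl)
  next
    case (incl s)
    then show ?case
      using hurwitz_equiv_pair_conj[OF ssC incl.hyps incl.prems] simple_inv[of s] assms(1) by auto
  next
    case (inv s)
    then show ?case
      using hurwitz_equiv_pair_conj[OF ssC inv.hyps inv.prems] ssC by (auto simp: subset_iff)
  next
    case (eng g h)
    have C: "g \<in> carrier G" "h \<in> carrier G" using eng.hyps generate_in_carrier[OF ssC] by auto
    let ?t = "h \<otimes> t \<otimes> inv h"
    have "?t \<otimes> ?t = h \<otimes> (t \<otimes> t) \<otimes> inv h" using C eng.prems(1) by (simp add: m_assoc conj_simps)
    then have t: "?t \<in> carrier G" "?t \<otimes> ?t = \<one>" using C eng.prems by auto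
    have "hurwitz_equiv G (ss @ [t, t]) (ss @ [?t, ?t])" by (rule eng.IH(2)[OF eng.prems])
    also have "hurwitz_equiv G (ss @ [?t, ?t]) (ss @ [g \<otimes> ?t \<otimes> inv g, g \<otimes> ?t \<otimes> inv g])"
      by (rule eng.IH(1)[OF t])
    also have "g \<otimes> ?t \<otimes> inv g = g \<otimes> h \<otimes> t \<otimes> inv (g \<otimes> h)"
      using C eng.prems by (simp add: inv_mult_group m_assoc)
    finally show ?case .
  qed
qed

end

lemma (in group_hom) hom_tuple_prod:
  assumes "set ts \<subseteq> carrier G"
  shows "h (tuple_prod G ts) = tuple_prod H (map h ts)"
  using assms
proof (induction ts)
  case (Cons t ts)
  then show ?case by (simp add: G.tuple_prod_Cons H.tuple_prod_Cons G.tuple_prod_closed)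
qed (simp add: tuple_prod_def)

lemma (in group_hom) hom_reflections:
  assumes "S \<subseteq> carrier G" "t \<in> reflections G S"
  shows "h t \<in> reflections H (h ` S)"
proof -
  obtain w s where "w \<in> carrier G" "s \<in> S" "t = w \<otimes> s \<otimes> inv w"
    using assms(2) by (auto simp: reflections_def)
  then show ?thesis using assms(1) unfolding reflections_def
    by (intro CollectI exI[of _ "h w"] exI[of _ "h s"]) auto
qed

section \<open>Transitivity of the Hurwitz action\<close>

theorem theorem6p19:
  fixes B :: "'v::real_vector \<Rightarrow> 'v \<Rightarrow> real" and \<alpha> :: "nat \<Rightarrow> 'v" and n :: nat
    and Wbar :: "'w monoid" and sbar :: "nat \<Rightarrow> 'w" and p :: "('v \<Rightarrow> 'v) \<Rightarrow> 'w"
    and s S W T c Sbar Tbar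
  defines "s \<equiv> \<lambda>i. reflect B (\<alpha> i)"
    and "S \<equiv> simple_refls B \<alpha> n"
    and "W \<equiv> refl_group B \<alpha> n"
    and "T \<equiv> reflections W S"
    and "c \<equiv> tuple_prod W (map s [1..<n + 1])"
    and "Sbar \<equiv> sbar ` {1..n - 1}"
    and "Tbar \<equiv> reflections Wbar Sbar"
  assumes "generalized_coxeter_datum B \<alpha> n"
    and "n \<ge> 2"
    and "card S = n"
    and "refl_length W T c = n"
    and "coxeter_system Wbar Sbar"
    and "inj_on sbar {1..n - 1}"
    and "p \<in> epi W Wbar"
    and T1: "\<forall>i\<in>{1..n - 1}. p (s i) = sbar i" "p (s n) = sbar (n - 1)"
    and T2: "\<forall>tbar\<in>Tbar.
      (\<exists>ts\<in>Red W T c. map p ts = map sbar [1..<n - 1] @ [tbar, tbar]) \<longrightarrow>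
      (\<exists>w\<in>generate Wbar (sbar ` {1..n - 2}).
         tbar = w \<otimes>\<^bsub>Wbar\<^esub> sbar (n - 1) \<otimes>\<^bsub>Wbar\<^esub> inv\<^bsub>Wbar\<^esub> w)"
    and T3: "\<forall>ts\<in>Red W T c.
      map p ts = map sbar [1..<n - 1] @ [sbar (n - 1), sbar (n - 1)] \<longrightarrow>
      ts \<in> orbit ((braid_group n)\<lparr>carrier := generate (braid_group n) {braid_gen n (n - 1)}\<rparr>)
             (hurwitz_action W (Red W T c)) (map s [1..<n + 1])"
  shows "transitive_action (braid_group n) (Red W T c) (hurwitz_action W (Red W T c))"
proof -
  let ?R = "Red W T c" and ?ss = "map sbar [1..<n - 1]"
  interpret datum: generalized_coxeter_datum B \<alpha> n by fact
  interpret W: group W unfolding W_def by (rule datum.group_refl_group)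
  have S_carrier: "S \<subseteq> carrier W" unfolding S_def W_def by (rule datum.simple_refls_carrier)
  interpret Wbar: coxeter_group Wbar Sbar
    using \<open>coxeter_system Wbar Sbar\<close>
    by (intro coxeter_group.intro coxeter_group_axioms.intro) (simp add: coxeter_system_def)
  interpret p: group_hom W Wbar p
    using \<open>p \<in> epi W Wbar\<close> by unfold_locales (simp add: epi_def)
  have n_eq: "n = refl_length W T c" using \<open>refl_length W T c = n\<close> by simp
  interpret act: group_action "braid_group n" ?R "hurwitz_action W ?R"
    using W.hurwitz_action_Red[OF S_carrier n_eq[unfolded T_def]] by (simp add: T_def)

  have T_carrier: "T \<subseteq> carrier W" unfolding T_def by (rule W.reflections_carrier[OF S_carrier])
  have R: "length ts = n" "set ts \<subseteq> T" "set ts \<subseteq> carrier W" "tuple_prod W ts = c" if "ts \<in> ?R" for ts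
    using that T_carrier by (auto simp: Red_def \<open>refl_length W T c = n\<close>)
  have s_S: "s i \<in> S" if "i \<in> {1..n}" for i using that by (auto simp: S_def simple_refls_def s_def)
  have S_T: "S \<subseteq> T"
  proof
    fix x assume "x \<in> S"
    with S_carrier show "x \<in> T" unfolding T_def reflections_def
      by (intro CollectI exI[of _ "\<one>\<^bsub>W\<^esub>"] exI[of _ x]) auto
  qed
  have s_R: "map s [1..<n + 1] \<in> ?R"
  proof -
    have "set (map s [1..<n + 1]) \<subseteq> T" using s_S S_T by auto
    then show ?thesis
      by (simp only: Red_def mem_Collect_eq c_def[symmetric] \<open>refl_length W T c = n\<close>) simp
  qed
  have R_equiv: "us \<in> ?R" if "ts \<in> ?R" "hurwitz_equiv W ts us" for ts us
    using that R[OF that(1)] W.hurwitz_equiv_reflections[OF that(2) S_carrier]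
      W.hurwitz_equiv_prod[OF that(2)] hurwitz_equiv_length[OF that(2)]
    by (auto simp: Red_def T_def[symmetric] \<open>refl_length W T c = n\<close>)
  have pS: "p ` S \<subseteq> Sbar"
  proof -
    have "p (s i) \<in> Sbar" if "i \<in> {1..n}" for i
      using T1 that \<open>n \<ge> 2\<close> by (cases "i = n") (auto simp: Sbar_def)
    then show ?thesis by (auto simp: S_def simple_refls_def s_def)
  qed
  have pT: "p t \<in> Tbar" if "t \<in> T" for t
  proof -
    have "p t \<in> reflections Wbar (p ` S)" using p.hom_reflections[OF S_carrier] that by (simp add: T_def)
    then show ?thesis using pS by (auto simp: Tbar_def reflections_def)
  qed
  have ss_S: "set ?ss \<subseteq> Sbar" by (auto simp: Sbar_def)
  have ss_distinct: "distinct ?ss"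
    using \<open>inj_on sbar {1..n - 1}\<close> by (auto simp: distinct_map intro: inj_on_subset)
  have ss_set: "set ?ss = sbar ` {1..n - 2}" using \<open>n \<ge> 2\<close> by auto
  have s_last: "sbar (n - 1) \<in> Sbar" using \<open>n \<ge> 2\<close> by (auto simp: Sbar_def)
  have pc: "p c = tuple_prod Wbar ?ss"
  proof -
    have "[1..<n + 1] = [1..<n - 1] @ [n - 1, n]"
      using \<open>n \<ge> 2\<close> upt_add_eq_append[of 1 "n - 1" 2] by (simp add: upt_rec)
    then have "map p (map s [1..<n + 1]) = ?ss @ [sbar (n - 1), sbar (n - 1)]"
      using T1 \<open>n \<ge> 2\<close> by auto
    then have "p c = tuple_prod Wbar (?ss @ [sbar (n - 1), sbar (n - 1)])"
      using p.hom_tuple_prod[OF R(3)[OF s_R]] by (simp add: c_def)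
    also have "\<dots> = tuple_prod Wbar ?ss \<otimes>\<^bsub>Wbar\<^esub> (sbar (n - 1) \<otimes>\<^bsub>Wbar\<^esub> sbar (n - 1))"
      using ss_S s_last Wbar.S_carrier
      by (subst Wbar.tuple_prod_append) (auto simp: tuple_prod_def)
    finally show ?thesis
      using Wbar.simple_square[OF s_last] Wbar.prod_closed[OF ss_S] by simp
  qed

  have orbit: "ts \<in> orbit (braid_group n) (hurwitz_action W ?R) (map s [1..<n + 1])" if ts: "ts \<in> ?R" for ts
  proof -
    have "set (map p ts) \<subseteq> Tbar" using R(2)[OF ts] pT by auto
    moreover have "tuple_prod Wbar (map p ts) = tuple_prod Wbar ?ss"
      using p.hom_tuple_prod[OF R(3)[OF ts]] R(4)[OF ts] pc by simp
    ultimately obtain ps where ps: "hurwitz_equiv Wbar (map p ts) (?ss @ concat (map (\<lambda>t. [t, t]) ps))"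
      using Wbar.factorization_hurwitz_equiv[OF ss_distinct ss_S] unfolding Tbar_def by blast
    \<comment> \<open>The projected tuple has two entries more than there are simple reflections in the product.\<close>
    have "length (concat (map (\<lambda>t. [t, t]) ps)) = 2 * length ps" by (induction ps) auto
    then have "length ps = 1"
      using hurwitz_equiv_length[OF ps] R(1)[OF ts] \<open>n \<ge> 2\<close> by simp
    then obtain t where "ps = [t]" by (cases ps) auto
    then have "hurwitz_equiv Wbar (map p ts) (?ss @ [t, t])" using ps by simp
    then obtain us where us: "hurwitz_equiv W ts us" "map p us = ?ss @ [t, t]"
      using p.hurwitz_equiv_lift R(3)[OF ts] by blast
    have us_R: "us \<in> ?R" using R_equiv[OF ts us(1)] .
    have "t \<in> set (map p us)" unfolding us(2) by simp
    then have t: "t \<in> Tbar" using R(2)[OF us_R] pT by auto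
    then obtain w where w: "w \<in> generate Wbar (set ?ss)"
      and t_eq: "t = w \<otimes>\<^bsub>Wbar\<^esub> sbar (n - 1) \<otimes>\<^bsub>Wbar\<^esub> inv\<^bsub>Wbar\<^esub> w"
      using T2 us_R us(2) unfolding ss_set by blast
    have wC: "w \<in> carrier Wbar" "sbar (n - 1) \<in> carrier Wbar" "set ?ss \<subseteq> carrier Wbar"
      using Wbar.generate_in_carrier[OF _ w] ss_S s_last Wbar.S_carrier by auto
    have "hurwitz_equiv Wbar (?ss @ [sbar (n - 1), sbar (n - 1)]) (?ss @ [t, t])"
      unfolding t_eq
      by (rule Wbar.hurwitz_equiv_pair_conj_generate[OF ss_S w wC(2) Wbar.simple_square[OF s_last]])
    then have "hurwitz_equiv Wbar (map p us) (?ss @ [sbar (n - 1), sbar (n - 1)])"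
      unfolding us(2) by (rule Wbar.hurwitz_equiv_sym) (use wC in auto)
    then obtain vs where vs: "hurwitz_equiv W us vs" "map p vs = ?ss @ [sbar (n - 1), sbar (n - 1)]"
      using p.hurwitz_equiv_lift R(3)[OF us_R] by blast
    have vs_R: "vs \<in> ?R" using R_equiv[OF us_R vs(1)] .
    have "braid_gen n (n - 1) \<in> carrier (braid_group n)"
      using \<open>n \<ge> 2\<close> by (auto simp: braid_gen_def braid_group_def pres_gen_def presented_group_def
          intro!: quotientI)
    then have "generate (braid_group n) {braid_gen n (n - 1)} \<subseteq> carrier (braid_group n)"
      unfolding braid_group_def by (intro group.generate_incl[OF group_presented_group]) blast
    moreover have "vs \<in> orbit ((braid_group n)\<lparr>carrier := generate (braid_group n) {braid_gen n (n - 1)}\<rparr>)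
        (hurwitz_action W ?R) (map s [1..<n + 1])"
      using T3 vs_R vs(2) by blast
    ultimately have 1: "vs \<in> orbit (braid_group n) (hurwitz_action W ?R) (map s [1..<n + 1])"
      by (auto simp: orbit_def)
    have "hurwitz_equiv W ts vs" using hurwitz_equiv_trans[OF us(1) vs(1)] .
    then have "vs \<in> orbit (braid_group n) (hurwitz_action W ?R) ts"
      using R ts by (intro W.hurwitz_equiv_imp_orbit) auto
    then have "ts \<in> orbit (braid_group n) (hurwitz_action W ?R) vs"
      using act.orbit_sym ts vs_R by blast
    with 1 show ?thesis using act.orbit_trans s_R vs_R ts by blast
  qed
  show ?thesis
  proof
    fix x y assume xy: "x \<in> ?R" "y \<in> ?R"
    have "map s [1..<n + 1] \<in> orbit (braid_group n) (hurwitz_action W ?R) x"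
      using act.orbit_sym s_R xy(1) orbit by blast
    then have "y \<in> orbit (braid_group n) (hurwitz_action W ?R) x"
      using act.orbit_trans s_R xy orbit by blast
    then show "\<exists>g\<in>carrier (braid_group n). hurwitz_action W ?R g x = y" by (auto simp: orbit_def)
  qed
qed

end
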